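(* Let $n\ge 2$ and $m\ge 2$ be integers. In the projective space $\mathbb{C}\mathbb{P}^{n^m-1}$ of nonzero $n$-dimensional $m$th order complex hypermatrices up to scalar multiplication, the set of (classes of) hypermatrices with infinitely many eigenpairs, counted up to equivalence of eigenpairs, has codimension at least $2$.
   Context: For a hypermatrix $A=(a_{i_1\cdots i_m})$ with complex entries, $1\le i_1,\dots,i_m\le n$, and $x\in\mathbb{C}^n$, $Ax^{m-1}$ is the vector with components $(Ax^{m-1})_i=\sum_{i_2,\dots,i_m=1}^n a_{ii_2\cdots i_m}x_{i_2}\cdots x_{i_m}$. An eigenpair of $A$ is a pair $(\lambda,x)$ with $\lambda\in\mathbb{C}$, $x\in\mathbb{C}^n\setminus\{0\}$ and $Ax^{m-1}=\lambda x$. Two eigenpairs $(\lambda,x)$ and $(\lambda',x')$ are equivalent if there is a complex number $t\ne0$ with $\lambda'=t^{m-2}\lambda$ and $x'=tx$. The codimension of a subset means the codimension of its Zariski closure. *)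

theory Defs
  imports
    "HOL-Analysis.Analysis"
    "HOL-Library.Poly_Mapping"
    "HOL-Library.Extended_Nat"
begin

section \<open>Coordinate spaces and projective spaces\<close>

text \<open>The vector space of families of complex numbers indexed by a finite set \<open>I\<close>. A family is
  represented by a total function vanishing outside \<open>I\<close>, so that equality of families is equality
  of functions.\<close>

definition coord_space :: "'i set \<Rightarrow> ('i \<Rightarrow> complex) set" where
  "coord_space I = {a. \<forall>i. i \<notin> I \<longrightarrow> a i = 0}"

definition nonzero_vectors :: "'i set \<Rightarrow> ('i \<Rightarrow> complex) set" where
  "nonzero_vectors I = coord_space I - {\<lambda>_. 0}"

definition proportional :: "'i set \<Rightarrow> (('i \<Rightarrow> complex) \<times> ('i \<Rightarrow> complex)) set" where
  "proportional I = {(a, b) \<in> nonzero_vectors I \<times> nonzero_vectors I.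
     \<exists>c. c \<noteq> 0 \<and> b = (\<lambda>i. c * a i)}"

definition proj_space :: "'i set \<Rightarrow> ('i \<Rightarrow> complex) set set" where
  "proj_space I = nonzero_vectors I // proportional I"

lemma equiv_proportional: "equiv (nonzero_vectors I) (proportional I)"
proof (rule equivI)
  show "refl_on (nonzero_vectors I) (proportional I)"
    unfolding proportional_def refl_on_def by (auto intro!: exI[of _ 1])
  show "sym (proportional I)"
  proof (rule symI)
    fix a b assume "(a, b) \<in> proportional I"
    then obtain c where "a \<in> nonzero_vectors I" "b \<in> nonzero_vectors I" "c \<noteq> 0"
      "b = (\<lambda>i. c * a i)" unfolding proportional_def by auto
    then show "(b, a) \<in> proportional I"
      unfolding proportional_def by (auto intro!: exI[of _ "inverse c"])
  qed
  show "trans (proportional I)"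
  proof (rule transI)
    fix a b d assume "(a, b) \<in> proportional I" "(b, d) \<in> proportional I"
    then obtain c c' where "a \<in> nonzero_vectors I" "d \<in> nonzero_vectors I" "c \<noteq> 0" "c' \<noteq> 0"
      "b = (\<lambda>i. c * a i)" "d = (\<lambda>i. c' * b i)" unfolding proportional_def by auto
    then show "(a, d) \<in> proportional I"
      unfolding proportional_def by (auto intro!: exI[of _ "c' * c"] simp: mult.assoc)
  qed
  show "proportional I \<subseteq> nonzero_vectors I \<times> nonzero_vectors I"
    unfolding proportional_def by auto
qed


section \<open>The Zariski topology on projective space\<close>

text \<open>A polynomial with complex coefficients in variables of type \<open>'i\<close> maps monomials (exponent
  vectors) to coefficients.\<close>

type_synonym 'i cpoly = "('i \<Rightarrow>\<^sub>0 nat) \<Rightarrow>\<^sub>0 complex"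

definition monom_eval :: "('i \<Rightarrow>\<^sub>0 nat) \<Rightarrow> ('i \<Rightarrow> complex) \<Rightarrow> complex" where
  "monom_eval s a = (\<Prod>i\<in>Poly_Mapping.keys s. a i ^ Poly_Mapping.lookup s i)"

definition poly_eval :: "'i cpoly \<Rightarrow> ('i \<Rightarrow> complex) \<Rightarrow> complex" where
  "poly_eval p a = (\<Sum>s\<in>Poly_Mapping.keys p. Poly_Mapping.lookup p s * monom_eval s a)"

definition monom_degree :: "('i \<Rightarrow>\<^sub>0 nat) \<Rightarrow> nat" where
  "monom_degree s = (\<Sum>i\<in>Poly_Mapping.keys s. Poly_Mapping.lookup s i)"

definition homogeneous_polys :: "'i set \<Rightarrow> 'i cpoly set" where
  "homogeneous_polys I = {p. \<exists>d. \<forall>s\<in>Poly_Mapping.keys p.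
     Poly_Mapping.keys s \<subseteq> I \<and> monom_degree s = d}"

definition zero_locus :: "'i set \<Rightarrow> 'i cpoly set \<Rightarrow> ('i \<Rightarrow> complex) set set" where
  "zero_locus I F = {P \<in> proj_space I. \<forall>f\<in>F. \<forall>a\<in>P. poly_eval f a = 0}"

definition zariski :: "'i set \<Rightarrow> ('i \<Rightarrow> complex) set topology" where
  "zariski I = topology (\<lambda>U. U \<subseteq> proj_space I \<and>
     (\<exists>F. F \<subseteq> homogeneous_polys I \<and> proj_space I - U = zero_locus I F))"

lemma monom_eval_superset:
  assumes "finite K" "Poly_Mapping.keys s \<subseteq> K"
  shows "monom_eval s a = (\<Prod>i\<in>K. a i ^ Poly_Mapping.lookup s i)"
  unfolding monom_eval_def
  by (rule prod.mono_neutral_left) (use assms in \<open>auto simp: in_keys_iff\<close>)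

lemma monom_degree_superset:
  assumes "finite K" "Poly_Mapping.keys s \<subseteq> K"
  shows "monom_degree s = (\<Sum>i\<in>K. Poly_Mapping.lookup s i)"
  unfolding monom_degree_def
  by (rule sum.mono_neutral_left) (use assms in \<open>auto simp: in_keys_iff\<close>)

lemma monom_eval_add: "monom_eval (s + t) a = monom_eval s a * monom_eval t a"
proof -
  let ?K = "Poly_Mapping.keys s \<union> Poly_Mapping.keys t"
  have "monom_eval (s + t) a = (\<Prod>i\<in>?K. a i ^ Poly_Mapping.lookup (s + t) i)"
    using keys_add[of s t] by (intro monom_eval_superset) auto
  also have "\<dots> = (\<Prod>i\<in>?K. a i ^ Poly_Mapping.lookup s i) * (\<Prod>i\<in>?K. a i ^ Poly_Mapping.lookup t i)"
    by (simp add: lookup_add power_add prod.distrib)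
  also have "\<dots> = monom_eval s a * monom_eval t a"
    by (simp add: monom_eval_superset[of ?K])
  finally show ?thesis .
qed

lemma monom_degree_add: "monom_degree (s + t) = monom_degree s + monom_degree t"
proof -
  let ?K = "Poly_Mapping.keys s \<union> Poly_Mapping.keys t"
  have "monom_degree (s + t) = (\<Sum>i\<in>?K. Poly_Mapping.lookup (s + t) i)"
    using keys_add[of s t] by (intro monom_degree_superset) auto
  also have "\<dots> = (\<Sum>i\<in>?K. Poly_Mapping.lookup s i) + (\<Sum>i\<in>?K. Poly_Mapping.lookup t i)"
    by (simp add: lookup_add sum.distrib)
  also have "\<dots> = monom_degree s + monom_degree t"
    by (simp add: monom_degree_superset[of ?K])
  finally show ?thesis .
qed

lemma poly_eval_superset:
  assumes "finite K" "Poly_Mapping.keys p \<subseteq> K"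
  shows "poly_eval p a = (\<Sum>s\<in>K. Poly_Mapping.lookup p s * monom_eval s a)"
  unfolding poly_eval_def
  by (rule sum.mono_neutral_left) (use assms in \<open>auto simp: in_keys_iff\<close>)

lemma poly_eval_zero [simp]: "poly_eval 0 a = 0"
  by (simp add: poly_eval_def)

lemma poly_eval_add: "poly_eval (p + q) a = poly_eval p a + poly_eval q a"
proof -
  let ?K = "Poly_Mapping.keys p \<union> Poly_Mapping.keys q"
  have "poly_eval (p + q) a = (\<Sum>s\<in>?K. Poly_Mapping.lookup (p + q) s * monom_eval s a)"
    using keys_add[of p q] by (intro poly_eval_superset) auto
  then show ?thesis
    by (simp add: poly_eval_superset[of ?K] lookup_add distrib_right sum.distrib)
qed

lemma poly_eval_sum: "poly_eval (\<Sum>x\<in>X. f x) a = (\<Sum>x\<in>X. poly_eval (f x) a)"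
  by (induction X rule: infinite_finite_induct) (auto simp: poly_eval_add)

lemma poly_eval_single: "poly_eval (Poly_Mapping.single s c) a = c * monom_eval s a"
  by (cases "c = 0") (auto simp: poly_eval_def)

lemma cpoly_as_sum:
  fixes p :: "'i cpoly"
  shows "p = (\<Sum>s\<in>Poly_Mapping.keys p. Poly_Mapping.single s (Poly_Mapping.lookup p s))"
  by (rule poly_mapping_eqI) (auto simp: lookup_sum lookup_single when_def in_keys_iff)

lemma poly_eval_mult: "poly_eval (p * q) a = poly_eval p a * poly_eval q a"
proof -
  have "p * q = (\<Sum>s\<in>Poly_Mapping.keys p. Poly_Mapping.single s (Poly_Mapping.lookup p s)) *
      (\<Sum>t\<in>Poly_Mapping.keys q. Poly_Mapping.single t (Poly_Mapping.lookup q t))"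
    using cpoly_as_sum[of p] cpoly_as_sum[of q] by simp
  also have "\<dots> = (\<Sum>s\<in>Poly_Mapping.keys p. \<Sum>t\<in>Poly_Mapping.keys q.
      Poly_Mapping.single (s + t) (Poly_Mapping.lookup p s * Poly_Mapping.lookup q t))"
    by (simp add: sum_product mult_single)
  finally have eq: "p * q = (\<Sum>s\<in>Poly_Mapping.keys p. \<Sum>t\<in>Poly_Mapping.keys q.
      Poly_Mapping.single (s + t) (Poly_Mapping.lookup p s * Poly_Mapping.lookup q t))" .
  show ?thesis
    unfolding eq poly_eval_sum poly_eval_single monom_eval_add
    unfolding poly_eval_def sum_product by (simp add: mult_ac)
qed

lemma homogeneous_polys_mult:
  assumes "p \<in> homogeneous_polys I" "q \<in> homogeneous_polys I"
  shows "p * q \<in> homogeneous_polys I"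
proof -
  obtain d where d: "\<And>s. s \<in> Poly_Mapping.keys p \<Longrightarrow> Poly_Mapping.keys s \<subseteq> I \<and> monom_degree s = d"
    using assms(1) unfolding homogeneous_polys_def by blast
  obtain e where e: "\<And>s. s \<in> Poly_Mapping.keys q \<Longrightarrow> Poly_Mapping.keys s \<subseteq> I \<and> monom_degree s = e"
    using assms(2) unfolding homogeneous_polys_def by blast
  have "Poly_Mapping.keys s \<subseteq> I \<and> monom_degree s = d + e" if s: "s \<in> Poly_Mapping.keys (p * q)" for s
  proof -
    obtain u v where uv: "u \<in> Poly_Mapping.keys p" "v \<in> Poly_Mapping.keys q" "s = u + v"
      using s keys_mult[of p q] by blast
    then show ?thesis
      using d[OF uv(1)] e[OF uv(2)] keys_add[of u v] by (auto simp: monom_degree_add)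
  qed
  then show ?thesis unfolding homogeneous_polys_def by blast
qed

lemma monom_eval_scale: "monom_eval s (\<lambda>i. c * a i) = c ^ monom_degree s * monom_eval s a"
  by (simp add: monom_eval_def monom_degree_def power_mult_distrib prod.distrib power_sum)

lemma poly_eval_scale_eq_0_iff:
  assumes "p \<in> homogeneous_polys I" "c \<noteq> 0"
  shows "poly_eval p (\<lambda>i. c * a i) = 0 \<longleftrightarrow> poly_eval p a = 0"
proof -
  obtain d where d: "\<And>s. s \<in> Poly_Mapping.keys p \<Longrightarrow> monom_degree s = d"
    using assms(1) unfolding homogeneous_polys_def by blast
  have "poly_eval p (\<lambda>i. c * a i) = c ^ d * poly_eval p a"
    by (simp add: poly_eval_def monom_eval_scale d sum_distrib_left mult_ac)
  then show ?thesis using assms(2) by simp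
qed

lemma poly_eval_eq_0_proj_space:
  assumes "p \<in> homogeneous_polys I" "P \<in> proj_space I" "a \<in> P" "b \<in> P"
  shows "poly_eval p a = 0 \<longleftrightarrow> poly_eval p b = 0"
proof -
  have "(a, b) \<in> proportional I"
    using assms(2-4) quotient_eq_iff[OF equiv_proportional] unfolding proj_space_def by blast
  then show ?thesis
    using poly_eval_scale_eq_0_iff[OF assms(1)] unfolding proportional_def by auto
qed

lemma zero_locus_Un:
  assumes "F \<subseteq> homogeneous_polys I" "G \<subseteq> homogeneous_polys I"
  shows "zero_locus I F \<union> zero_locus I G = zero_locus I {f * g |f g. f \<in> F \<and> g \<in> G}"
proof
  show "zero_locus I F \<union> zero_locus I G \<subseteq> zero_locus I {f * g |f g. f \<in> F \<and> g \<in> G}"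
    unfolding zero_locus_def by (auto simp: poly_eval_mult)
  show "zero_locus I {f * g |f g. f \<in> F \<and> g \<in> G} \<subseteq> zero_locus I F \<union> zero_locus I G"
  proof
    fix P assume P: "P \<in> zero_locus I {f * g |f g. f \<in> F \<and> g \<in> G}"
    show "P \<in> zero_locus I F \<union> zero_locus I G"
    proof (rule ccontr)
      assume neg: "P \<notin> zero_locus I F \<union> zero_locus I G"
      have PI: "P \<in> proj_space I" using P unfolding zero_locus_def by simp
      obtain f a where f: "f \<in> F" "a \<in> P" "poly_eval f a \<noteq> 0"
        using neg PI unfolding zero_locus_def by auto
      obtain g b where g: "g \<in> G" "b \<in> P" "poly_eval g b \<noteq> 0"
        using neg PI unfolding zero_locus_def by auto
      have "poly_eval g a \<noteq> 0"
        using poly_eval_eq_0_proj_space[OF _ PI f(2) g(2)] g(1,3) assms(2) by blast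
      moreover have "poly_eval (f * g) a = 0"
        using P f(1,2) g(1) unfolding zero_locus_def by blast
      ultimately show False using f(3) by (simp add: poly_eval_mult)
    qed
  qed
qed

lemma zero_locus_Union: "zero_locus I (\<Union>x\<in>X. F x) = proj_space I \<inter> (\<Inter>x\<in>X. zero_locus I (F x))"
  unfolding zero_locus_def by auto

lemma istopology_zariski:
  "istopology (\<lambda>U. U \<subseteq> proj_space I \<and>
     (\<exists>F. F \<subseteq> homogeneous_polys I \<and> proj_space I - U = zero_locus I F))"
  (is "istopology ?open")
  unfolding istopology_def
proof (rule conjI; intro allI impI)
  fix S T assume S: "?open S" and T: "?open T"
  then obtain F G where FG: "F \<subseteq> homogeneous_polys I" "proj_space I - S = zero_locus I F"
    "G \<subseteq> homogeneous_polys I" "proj_space I - T = zero_locus I G" by blast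
  have "proj_space I - S \<inter> T = zero_locus I {f * g |f g. f \<in> F \<and> g \<in> G}"
    using FG zero_locus_Un[of F I G] by blast
  moreover have "{f * g |f g. f \<in> F \<and> g \<in> G} \<subseteq> homogeneous_polys I"
    using FG homogeneous_polys_mult by blast
  ultimately show "?open (S \<inter> T)" using S by blast
next
  fix \<K> assume K: "\<forall>K\<in>\<K>. ?open K"
  then obtain F where F: "\<And>K. K \<in> \<K> \<Longrightarrow> F K \<subseteq> homogeneous_polys I"
    "\<And>K. K \<in> \<K> \<Longrightarrow> proj_space I - K = zero_locus I (F K)" by metis
  have "proj_space I - \<Union>\<K> = proj_space I \<inter> (\<Inter>K\<in>\<K>. proj_space I - K)" by blast
  also have "\<dots> = zero_locus I (\<Union>K\<in>\<K>. F K)"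
    unfolding zero_locus_Union using F(2) by simp
  finally have "proj_space I - \<Union>\<K> = zero_locus I (\<Union>K\<in>\<K>. F K)" .
  moreover have "(\<Union>K\<in>\<K>. F K) \<subseteq> homogeneous_polys I" using F(1) by blast
  ultimately show "?open (\<Union>\<K>)" using K by blast
qed

lemma openin_zariski:
  "openin (zariski I) U \<longleftrightarrow> U \<subseteq> proj_space I \<and>
     (\<exists>F. F \<subseteq> homogeneous_polys I \<and> proj_space I - U = zero_locus I F)"
  unfolding zariski_def topology_inverse'[OF istopology_zariski] ..

lemma topspace_zariski [simp]: "topspace (zariski I) = proj_space I"
proof
  show "topspace (zariski I) \<subseteq> proj_space I"
    using openin_topspace[of "zariski I"] unfolding openin_zariski by blast
  have "zero_locus I {1} = {}"
  proof -
    have "\<exists>a. a \<in> P" if "P \<in> proj_space I" for P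
      using that in_quotient_imp_non_empty[OF equiv_proportional] unfolding proj_space_def by blast
    then show ?thesis
      by (auto simp: zero_locus_def poly_eval_def monom_eval_def)
  qed
  moreover have "{1} \<subseteq> homogeneous_polys I"
    by (auto simp: homogeneous_polys_def)
  ultimately have "openin (zariski I) (proj_space I)"
    unfolding openin_zariski by blast
  then show "proj_space I \<subseteq> topspace (zariski I)"
    by (rule openin_subset)
qed

lemma closedin_zariski:
  "closedin (zariski I) Z \<longleftrightarrow> (\<exists>F. F \<subseteq> homogeneous_polys I \<and> Z = zero_locus I F)"
proof -
  have "zero_locus I F \<subseteq> proj_space I" for F
    unfolding zero_locus_def by blast
  then show ?thesis
    unfolding closedin_def topspace_zariski openin_zariski by (auto simp: double_diff)
qed


section \<open>Codimension\<close>

definition irreducible_closed :: "'a topology \<Rightarrow> 'a set \<Rightarrow> bool" where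
  "irreducible_closed X Z \<longleftrightarrow> closedin X Z \<and> Z \<noteq> {} \<and>
     (\<forall>A B. closedin X A \<and> closedin X B \<and> Z = A \<union> B \<longrightarrow> Z = A \<or> Z = B)"

text \<open>The codimension of an irreducible closed set \<open>Z\<close> is the supremum of the lengths \<open>k\<close> of chains
  \<open>Z = C 0 \<subset> C 1 \<subset> \<dots> \<subset> C k\<close> of irreducible closed sets. The codimension of an arbitrary set is the
  smallest codimension of an irreducible closed subset of its closure (that is, of an irreducible
  component of the closure); it is \<open>\<infinity>\<close> for the empty set.\<close>

definition irreducible_codim :: "'a topology \<Rightarrow> 'a set \<Rightarrow> enat" where
  "irreducible_codim X Z = (SUP k \<in> {k. \<exists>C :: nat \<Rightarrow> 'a set. C 0 = Z \<and>
     (\<forall>i\<le>k. irreducible_closed X (C i)) \<and> (\<forall>i<k. C i \<subset> C (Suc i))}. enat k)"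

definition codimension :: "'a topology \<Rightarrow> 'a set \<Rightarrow> enat" where
  "codimension X S =
     (INF Z \<in> {Z. irreducible_closed X Z \<and> Z \<subseteq> X closure_of S}. irreducible_codim X Z)"


section \<open>Hypermatrices and eigenpairs\<close>

text \<open>Indices run over \<open>0, \<dots>, n - 1\<close>. The multi-index \<open>(i\<^sub>1, \<dots>, i\<^sub>m)\<close> is a list of length \<open>m\<close>, and an
  \<open>n\<close>-dimensional hypermatrix of order \<open>m\<close> is an element of \<open>coord_space (multi_indices n m)\<close>.\<close>

definition multi_indices :: "nat \<Rightarrow> nat \<Rightarrow> nat list set" where
  "multi_indices n m = {js. length js = m \<and> set js \<subseteq> {..<n}}"

definition hm_apply ::
  "nat \<Rightarrow> nat \<Rightarrow> (nat list \<Rightarrow> complex) \<Rightarrow> (nat \<Rightarrow> complex) \<Rightarrow> nat \<Rightarrow> complex" where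
  "hm_apply n m A x i =
     (if i < n then \<Sum>js\<in>multi_indices n (m - 1). A (i # js) * (\<Prod>j\<leftarrow>js. x j) else 0)"

definition eigenpairs ::
  "nat \<Rightarrow> nat \<Rightarrow> (nat list \<Rightarrow> complex) \<Rightarrow> (complex \<times> (nat \<Rightarrow> complex)) set" where
  "eigenpairs n m A =
     {(l, x). x \<in> nonzero_vectors {..<n} \<and> hm_apply n m A x = (\<lambda>i. l * x i)}"

definition eigenpair_rel :: "nat \<Rightarrow> nat \<Rightarrow> (nat list \<Rightarrow> complex) \<Rightarrow>
    ((complex \<times> (nat \<Rightarrow> complex)) \<times> (complex \<times> (nat \<Rightarrow> complex))) set" where
  "eigenpair_rel n m A = {((l, x), (l', x')) \<in> eigenpairs n m A \<times> eigenpairs n m A.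
     \<exists>t. t \<noteq> 0 \<and> l' = t ^ (m - 2) * l \<and> x' = (\<lambda>i. t * x i)}"

definition infinitely_many_eigenpairs :: "nat \<Rightarrow> nat \<Rightarrow> (nat list \<Rightarrow> complex) \<Rightarrow> bool" where
  "infinitely_many_eigenpairs n m A \<longleftrightarrow> infinite (eigenpairs n m A // eigenpair_rel n m A)"

definition degenerate_classes :: "nat \<Rightarrow> nat \<Rightarrow> (nat list \<Rightarrow> complex) set set" where
  "degenerate_classes n m = {proportional (multi_indices n m) `` {A} | A.
     A \<in> nonzero_vectors (multi_indices n m) \<and> infinitely_many_eigenpairs n m A}"

end

theory Submission
  imports Defs "Jordan_Normal_Form.Spectral_Radius"
begin

text \<open>Let \<open>p\<close> and \<open>q\<close> be the hypermatrices with \<open>(p x\<^bsup>m-1\<^esup>)\<^sub>i = x\<^bsub>i+1\<^esub>\<^bsup>m-1\<^esup>\<close> and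
  \<open>(q x\<^bsup>m-1\<^esup>)\<^sub>i = x\<^bsub>i-1\<^esub>\<^bsup>m-1\<^esup>\<close>, out-of-range coordinates being \<open>0\<close>. Apart from \<open>q\<close>, no member of
  the line through \<open>p\<close> and \<open>q\<close> has an eigenvector with \<open>x\<^sub>0 = 0\<close>, and \<open>q\<close> has none with \<open>x\<^bsub>n-1\<^esub> = 0\<close>;
  a hypermatrix with infinitely many eigenpairs has an eigenvector on every hyperplane. Writing the
  absence of such eigenvectors as the nonvanishing of determinants in the coefficients, one gets that
  the closure of the degenerate set misses \<open>q\<close>, and by elimination of \<open>t\<close> from two such determinants
  a polynomial \<open>R\<close> with \<open>R p \<noteq> 0\<close> that vanishes at every \<open>a\<close> for which some \<open>a + t q\<close> is degenerate.
  Hence every irreducible closed subset \<open>Z\<close> of the closure is properly contained in the join of \<open>Z\<close>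
  with \<open>q\<close>, which is irreducible and does not contain \<open>p\<close>.\<close>

section \<open>Polynomial functions and projective closed sets\<close>

text \<open>Having an eigenvector on a fixed hyperplane is one condition on the coefficients, in
  general a hypersurface, and every line meets a hypersurface. So a single hyperplane cannot give
  codimension 2: for \<open>x 0 = 0\<close> the line through \<open>p\<close> and \<open>q\<close>
  fails at \<open>q\<close>, which has the last unit vector as an eigenvector with eigenvalue 0. A
  second hyperplane repairs this one point. The determinant belonging to it has the form det(t -
  \<theta>(a)) and is monic in \<open>t\<close>. Hence \<open>t\<close> is integral over the
  polynomials in \<open>a\<close>, projection from \<open>q\<close> loses nothing at infinity, and
  eliminating \<open>t\<close> leaves a polynomial condition on \<open>a\<close> alone. Infinitely
  many eigenpairs force eigenvectors on hyperplanes because the eigenvectors then form a closed set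
  of positive dimension in projective space. The determinants express this by linear algebra on the
  monomials of one large degree, where ratios of coordinates become eigenvalues.\<close>

definition fun_algebra :: "('w \<Rightarrow> complex) set \<Rightarrow> bool" where
  "fun_algebra R \<longleftrightarrow> (\<forall>c. (\<lambda>_. c) \<in> R) \<and>
     (\<forall>f\<in>R. \<forall>g\<in>R. (\<lambda>w. f w + g w) \<in> R \<and> (\<lambda>w. f w * g w) \<in> R)"

lemma fun_algebraD:
  assumes "fun_algebra R"
  shows "(\<lambda>_. c) \<in> R"
    and "f \<in> R \<Longrightarrow> g \<in> R \<Longrightarrow> (\<lambda>w. f w + g w) \<in> R"
    and "f \<in> R \<Longrightarrow> g \<in> R \<Longrightarrow> (\<lambda>w. f w * g w) \<in> R"
  using assms by (auto simp: fun_algebra_def)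

lemma fun_algebra_sum:
  assumes R: "fun_algebra R" and "\<And>x. x \<in> X \<Longrightarrow> f x \<in> R"
  shows "(\<lambda>w. \<Sum>x\<in>X. f x w) \<in> R"
  using assms(2) by (induction X rule: infinite_finite_induct) (auto intro: fun_algebraD[OF R])

lemma fun_algebra_prod:
  assumes R: "fun_algebra R" and "\<And>x. x \<in> X \<Longrightarrow> f x \<in> R"
  shows "(\<lambda>w. \<Prod>x\<in>X. f x w) \<in> R"
  using assms(2) by (induction X rule: infinite_finite_induct) (auto intro: fun_algebraD[OF R])

text \<open>Polynomials are kept as functions, so that the affine substitutions behind scaling and
  joins are plain compositions. Formal coefficients are recovered by \<open>poly_funs_cpoly\<close>
  when homogeneous equations are wanted.\<close>

inductive_set poly_funs :: "'i set \<Rightarrow> (('i \<Rightarrow> complex) \<Rightarrow> complex) set" for I where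
  const: "(\<lambda>_. c) \<in> poly_funs I"
| coord: "i \<in> I \<Longrightarrow> (\<lambda>a. a i) \<in> poly_funs I"
| add: "f \<in> poly_funs I \<Longrightarrow> g \<in> poly_funs I \<Longrightarrow> (\<lambda>a. f a + g a) \<in> poly_funs I"
| mult: "f \<in> poly_funs I \<Longrightarrow> g \<in> poly_funs I \<Longrightarrow> (\<lambda>a. f a * g a) \<in> poly_funs I"

lemma fun_algebra_poly_funs: "fun_algebra (poly_funs I)"
  unfolding fun_algebra_def by (auto intro: poly_funs.intros)

lemmas poly_funs_sum = fun_algebra_sum[OF fun_algebra_poly_funs]
  and poly_funs_prod = fun_algebra_prod[OF fun_algebra_poly_funs]

lemma poly_funs_power:
  assumes "f \<in> poly_funs I"
  shows "(\<lambda>a. f a ^ k) \<in> poly_funs I"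
  using assms by (induction k) (auto intro: poly_funs.intros)

lemma poly_funs_affine:
  assumes "f \<in> poly_funs I"
  shows "(\<lambda>a. f (\<lambda>i. c * a i + b i)) \<in> poly_funs I"
  using assms
proof induction
  case (coord i)
  then show ?case
    by (intro poly_funs.add poly_funs.mult poly_funs.const poly_funs.coord)
qed (auto intro: poly_funs.intros)

lemma poly_funs_poly_eval:
  assumes "\<And>s. s \<in> Poly_Mapping.keys p \<Longrightarrow> Poly_Mapping.keys s \<subseteq> I"
  shows "poly_eval p \<in> poly_funs I"
proof -
  have "(\<lambda>a. \<Sum>s\<in>Poly_Mapping.keys p. Poly_Mapping.lookup p s *
      (\<Prod>i\<in>Poly_Mapping.keys s. a i ^ Poly_Mapping.lookup s i)) \<in> poly_funs I"
    using assms
    by (intro poly_funs_sum poly_funs.mult poly_funs.const poly_funs_prod poly_funs_power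
        poly_funs.coord) auto
  then show ?thesis by (simp add: poly_eval_def[abs_def] monom_eval_def)
qed

lemma poly_funs_line:
  assumes "f \<in> poly_funs I"
  shows "\<exists>P. \<forall>t. f (\<lambda>i. a i + t * b i) = poly P t"
  using assms
proof induction
  case (const c)
  show ?case by (rule exI[of _ "[:c:]"]) simp
next
  case (coord i)
  show ?case by (rule exI[of _ "[:a i, b i:]"]) simp
next
  case (add f g)
  then obtain P Q where "\<forall>t. f (\<lambda>i. a i + t * b i) = poly P t" "\<forall>t. g (\<lambda>i. a i + t * b i) = poly Q t"
    by blast
  then show ?case by (intro exI[of _ "P + Q"]) simp
next
  case (mult f g)
  then obtain P Q where "\<forall>t. f (\<lambda>i. a i + t * b i) = poly P t" "\<forall>t. g (\<lambda>i. a i + t * b i) = poly Q t"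
    by blast
  then show ?case by (intro exI[of _ "P * Q"]) simp
qed

lemma poly_eq_0_off_0:
  fixes P :: "complex poly"
  assumes "\<And>t. t \<noteq> 0 \<Longrightarrow> poly P t = 0"
  shows "P = 0"
proof (rule ccontr)
  assume "P \<noteq> 0"
  then have "finite {t. poly P t = 0}" by (rule poly_roots_finite)
  moreover have "UNIV - {0} \<subseteq> {t. poly P t = 0}" using assms by auto
  ultimately have "finite (UNIV - {0::complex})" by (rule rev_finite_subset)
  then show False by (simp add: infinite_UNIV_char_0)
qed

text \<open>Takes the place of a limit: it reaches the zero vector from nonzero vectors, and the
  vertex \<open>q\<close> of a join from the other points of a line through it.\<close>

lemma poly_funs_line_eq_0:
  assumes "f \<in> poly_funs I" "\<And>t. t \<noteq> 0 \<Longrightarrow> f (\<lambda>i. a i + t * b i) = 0"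
  shows "f a = 0"
proof -
  obtain P where P: "\<And>t. f (\<lambda>i. a i + t * b i) = poly P t"
    using poly_funs_line[OF assms(1)] by blast
  then have "P = 0" using assms(2) by (intro poly_eq_0_off_0) metis
  then show ?thesis using P[of 0] by simp
qed

text \<open>A line is irreducible, because univariate polynomials form an integral domain. Both
  irreducibility proofs below reduce to this.\<close>

lemma poly_funs_line_mult_eq_0:
  assumes "f \<in> poly_funs I" "g \<in> poly_funs I"
    and "\<And>t. f (\<lambda>i. a i + t * b i) = 0 \<or> g (\<lambda>i. a i + t * b i) = 0"
  shows "(\<forall>t. f (\<lambda>i. a i + t * b i) = 0) \<or> (\<forall>t. g (\<lambda>i. a i + t * b i) = 0)"
proof -
  obtain P Q where PQ: "\<And>t. f (\<lambda>i. a i + t * b i) = poly P t" "\<And>t. g (\<lambda>i. a i + t * b i) = poly Q t"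
    using poly_funs_line[OF assms(1)] poly_funs_line[OF assms(2)] by blast
  have "P * Q = 0"
    using assms(3) by (intro poly_eq_0_off_0) (auto simp: PQ)
  then show ?thesis unfolding PQ by auto
qed

lemma poly_funs_cpoly:
  assumes "f \<in> poly_funs I"
  shows "\<exists>p. (\<forall>s\<in>Poly_Mapping.keys p. Poly_Mapping.keys s \<subseteq> I) \<and> f = poly_eval p"
  using assms
proof induction
  case (const c)
  show ?case
    by (rule exI[of _ "Poly_Mapping.single 0 c"]) (auto simp: poly_eval_single monom_eval_def fun_eq_iff)
next
  case (coord i)
  have "monom_eval (Poly_Mapping.single i 1) = (\<lambda>a. a i)"
    by (simp add: monom_eval_def fun_eq_iff)
  then show ?case using coord
    by (intro exI[of _ "Poly_Mapping.single (Poly_Mapping.single i 1) 1"])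
      (auto simp: poly_eval_single fun_eq_iff)
next
  case (add f g)
  then obtain p q where
    "\<forall>s\<in>Poly_Mapping.keys p. Poly_Mapping.keys s \<subseteq> I" "f = poly_eval p"
    "\<forall>s\<in>Poly_Mapping.keys q. Poly_Mapping.keys s \<subseteq> I" "g = poly_eval q"
    by blast
  moreover have "Poly_Mapping.keys (p + q) \<subseteq> Poly_Mapping.keys p \<union> Poly_Mapping.keys q"
    by (rule keys_add)
  ultimately have "\<forall>s\<in>Poly_Mapping.keys (p + q). Poly_Mapping.keys s \<subseteq> I"
    "(\<lambda>a. f a + g a) = poly_eval (p + q)"
    by (blast, simp add: poly_eval_add fun_eq_iff)
  then show ?case by blast
next
  case (mult f g)
  then obtain p q where pq:
    "\<forall>s\<in>Poly_Mapping.keys p. Poly_Mapping.keys s \<subseteq> I" "f = poly_eval p"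
    "\<forall>s\<in>Poly_Mapping.keys q. Poly_Mapping.keys s \<subseteq> I" "g = poly_eval q"
    by blast
  have "Poly_Mapping.keys s \<subseteq> I" if s: "s \<in> Poly_Mapping.keys (p * q)" for s
  proof -
    obtain u v where "u \<in> Poly_Mapping.keys p" "v \<in> Poly_Mapping.keys q" "s = u + v"
      using s keys_mult[of p q] by blast
    then show ?thesis using pq(1,3) keys_add[of u v] by blast
  qed
  then show ?case using pq
    by (intro exI[of _ "p * q"]) (auto simp: poly_eval_mult fun_eq_iff)
qed

text \<open>For fixed \<open>a\<close>, the value of \<open>f\<close> at the multiple by
  \<open>c\<close> is a polynomial in \<open>c\<close> whose coefficients are the homogeneous parts
  of \<open>f\<close> at \<open>a\<close>. It vanishes for all nonzero \<open>c\<close> exactly when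
  every part does.\<close>

lemma poly_funs_homogeneous_parts:
  assumes "f \<in> poly_funs I"
  shows "\<exists>G \<subseteq> homogeneous_polys I.
    \<forall>a. (\<forall>g\<in>G. poly_eval g a = 0) \<longleftrightarrow> (\<forall>c. c \<noteq> 0 \<longrightarrow> f (\<lambda>i. c * a i) = 0)"
proof -
  obtain p where p: "\<And>s. s \<in> Poly_Mapping.keys p \<Longrightarrow> Poly_Mapping.keys s \<subseteq> I" "f = poly_eval p"
    using poly_funs_cpoly[OF assms] by blast
  define K where "K d = {s \<in> Poly_Mapping.keys p. monom_degree s = d}" for d
  define g where "g d = (\<Sum>s\<in>K d. Poly_Mapping.single s (Poly_Mapping.lookup p s))" for d
  define D where "D = monom_degree ` Poly_Mapping.keys p"
  have finK: "finite (K d)" for d by (simp add: K_def)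
  have g_eval: "poly_eval (g d) a = (\<Sum>s\<in>K d. Poly_Mapping.lookup p s * monom_eval s a)" for d a
    by (simp add: g_def poly_eval_sum poly_eval_single)
  have keys_g: "Poly_Mapping.keys (g d) \<subseteq> K d" for d
  proof
    fix s assume "s \<in> Poly_Mapping.keys (g d)"
    then have "Poly_Mapping.lookup (g d) s \<noteq> 0" by (simp add: in_keys_iff)
    then show "s \<in> K d"
      by (rule contrapos_np)
        (auto simp: g_def lookup_sum lookup_single when_def intro!: sum.neutral)
  qed
  have hom: "g d \<in> homogeneous_polys I" for d
  proof -
    have "\<forall>s\<in>Poly_Mapping.keys (g d). Poly_Mapping.keys s \<subseteq> I \<and> monom_degree s = d"
      using p(1) keys_g[of d] unfolding K_def by blast
    then show ?thesis unfolding homogeneous_polys_def by blast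
  qed
  have expand: "f (\<lambda>i. c * a i) = (\<Sum>d\<in>D. poly_eval (g d) a * c ^ d)" for c a
  proof -
    have "f (\<lambda>i. c * a i) =
        (\<Sum>s\<in>Poly_Mapping.keys p. Poly_Mapping.lookup p s * monom_eval s a * c ^ monom_degree s)"
      by (simp add: p(2) poly_eval_def monom_eval_scale mult_ac)
    also have "\<dots> = (\<Sum>d\<in>D. \<Sum>s\<in>K d. Poly_Mapping.lookup p s * monom_eval s a * c ^ monom_degree s)"
      unfolding D_def K_def by (rule sum.image_gen) simp
    also have "\<dots> = (\<Sum>d\<in>D. poly_eval (g d) a * c ^ d)"
      unfolding g_eval sum_distrib_right by (intro sum.cong refl) (simp add: K_def)
    finally show ?thesis .
  qed
  have "(\<forall>d\<in>D. poly_eval (g d) a = 0) \<longleftrightarrow> (\<forall>c. c \<noteq> 0 \<longrightarrow> f (\<lambda>i. c * a i) = 0)" for a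
  proof
    assume "\<forall>d\<in>D. poly_eval (g d) a = 0"
    then show "\<forall>c. c \<noteq> 0 \<longrightarrow> f (\<lambda>i. c * a i) = 0"
      unfolding expand by simp
  next
    assume vanish: "\<forall>c. c \<noteq> 0 \<longrightarrow> f (\<lambda>i. c * a i) = 0"
    define P where "P = (\<Sum>d\<in>D. monom (poly_eval (g d) a) d)"
    have "P = 0"
      using vanish by (intro poly_eq_0_off_0) (simp add: expand P_def poly_sum poly_monom)
    moreover have "coeff P d = poly_eval (g d) a" if "d \<in> D" for d
      using that by (simp add: P_def coeff_sum D_def)
    ultimately show "\<forall>d\<in>D. poly_eval (g d) a = 0" by auto
  qed
  then show ?thesis
    using hom by (intro exI[of _ "g ` D"]) auto
qed

section \<open>Closed sets of projective space as cones of representatives\<close>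

definition lines :: "'i set \<Rightarrow> ('i \<Rightarrow> complex) set \<Rightarrow> ('i \<Rightarrow> complex) set set" where
  "lines I X = (\<lambda>a. proportional I `` {a}) ` X"

definition is_cone :: "'i set \<Rightarrow> ('i \<Rightarrow> complex) set \<Rightarrow> bool" where
  "is_cone I X \<longleftrightarrow> X \<subseteq> nonzero_vectors I \<and> (\<forall>a\<in>X. \<forall>c. c \<noteq> 0 \<longrightarrow> (\<lambda>i. c * a i) \<in> X)"

definition cone_of :: "'i set \<Rightarrow> (('i \<Rightarrow> complex) \<Rightarrow> complex) set \<Rightarrow> ('i \<Rightarrow> complex) set" where
  "cone_of I F = {a \<in> nonzero_vectors I. \<forall>f\<in>F. f a = 0}"

text \<open>The equations in \<open>F\<close> may be inhomogeneous; invariance under scaling is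
  demanded separately by \<open>is_cone\<close>. Sets cut out by translated polynomials, as for the
  join, can thus be defined directly.\<close>

definition alg_cone :: "'i set \<Rightarrow> ('i \<Rightarrow> complex) set \<Rightarrow> bool" where
  "alg_cone I X \<longleftrightarrow> is_cone I X \<and> (\<exists>F \<subseteq> poly_funs I. X = cone_of I F)"

lemma nonzero_vectors_scale:
  "a \<in> nonzero_vectors I \<Longrightarrow> c \<noteq> 0 \<Longrightarrow> (\<lambda>i. c * a i) \<in> nonzero_vectors I"
  by (auto simp: nonzero_vectors_def coord_space_def fun_eq_iff)

lemma is_coneD: "is_cone I X \<Longrightarrow> a \<in> X \<Longrightarrow> c \<noteq> 0 \<Longrightarrow> (\<lambda>i. c * a i) \<in> X"
  by (simp add: is_cone_def)

lemma line_self: "a \<in> nonzero_vectors I \<Longrightarrow> a \<in> proportional I `` {a}"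
  by (rule equiv_class_self[OF equiv_proportional])

lemma Union_lines:
  assumes "is_cone I X"
  shows "\<Union>(lines I X) = X"
proof
  show "\<Union>(lines I X) \<subseteq> X"
    using assms by (auto simp: lines_def is_cone_def proportional_def)
  show "X \<subseteq> \<Union>(lines I X)"
  proof
    fix a assume a: "a \<in> X"
    then have "a \<in> nonzero_vectors I" using assms by (auto simp: is_cone_def)
    then show "a \<in> \<Union>(lines I X)"
      unfolding lines_def by (rule UnionI[OF imageI[OF a] line_self])
  qed
qed

lemma lines_strict_mono:
  assumes "is_cone I X" "is_cone I Y" "X \<subset> Y"
  shows "lines I X \<subset> lines I Y"
proof -
  have "lines I X \<subseteq> lines I Y"
    unfolding lines_def by (intro image_mono psubset_imp_subset assms(3))
  moreover have "lines I X \<noteq> lines I Y"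
  proof
    assume "lines I X = lines I Y"
    then have "X = Y" by (metis Union_lines assms(1,2))
    then show False using assms(3) by simp
  qed
  ultimately show ?thesis by (rule psubsetI)
qed

lemma lines_subset: "is_cone I X \<Longrightarrow> lines I X \<subseteq> proj_space I"
  by (auto simp: lines_def is_cone_def proj_space_def intro: quotientI)

lemma lines_Union:
  assumes "Z \<subseteq> proj_space I"
  shows "lines I (\<Union>Z) = Z"
proof -
  have *: "proportional I `` {a} = P" if "P \<in> Z" "a \<in> P" for P a
  proof -
    have P: "P \<in> nonzero_vectors I // proportional I"
      using assms that(1) by (auto simp: proj_space_def)
    have "a \<in> nonzero_vectors I"
      using in_quotient_imp_subset[OF equiv_proportional P] that(2) by blast
    then have "proportional I `` {a} \<in> nonzero_vectors I // proportional I"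
      and "a \<in> proportional I `` {a}"
      by (auto intro: quotientI simp del: Image_singleton_iff dest: line_self)
    then show ?thesis
      using quotient_disj[OF equiv_proportional P] that(2) by blast
  qed
  show ?thesis
  proof
    show "lines I (\<Union>Z) \<subseteq> Z" using * by (auto simp: lines_def)
    show "Z \<subseteq> lines I (\<Union>Z)"
    proof
      fix P assume P: "P \<in> Z"
      then obtain a where "a \<in> P"
        using in_quotient_imp_non_empty[OF equiv_proportional] assms
        unfolding proj_space_def by blast
      then show "P \<in> lines I (\<Union>Z)" using * P unfolding lines_def by blast
    qed
  qed
qed

text \<open>A point of a cone satisfies each equation at all its nonzero multiples, so every
  equation may be split into its homogeneous parts without changing the solutions.\<close>

lemma closedin_lines:
  assumes "alg_cone I X"
  shows "closedin (zariski I) (lines I X)"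
proof -
  obtain F where F: "F \<subseteq> poly_funs I" "X = cone_of I F" and cone: "is_cone I X"
    using assms by (auto simp: alg_cone_def)
  have "\<forall>f\<in>F. \<exists>G \<subseteq> homogeneous_polys I.
      \<forall>a. (\<forall>g\<in>G. poly_eval g a = 0) \<longleftrightarrow> (\<forall>c. c \<noteq> 0 \<longrightarrow> f (\<lambda>i. c * a i) = 0)"
    using F(1) poly_funs_homogeneous_parts by blast
  then obtain G where G: "\<And>f. f \<in> F \<Longrightarrow> G f \<subseteq> homogeneous_polys I"
    "\<And>f a. f \<in> F \<Longrightarrow> (\<forall>g\<in>G f. poly_eval g a = 0) \<longleftrightarrow> (\<forall>c. c \<noteq> 0 \<longrightarrow> f (\<lambda>i. c * a i) = 0)"
    by metis
  define H where "H = (\<Union>f\<in>F. G f)"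
  have H: "H \<subseteq> homogeneous_polys I" using G(1) by (auto simp: H_def)
  have iff: "(\<forall>h\<in>H. poly_eval h a = 0) \<longleftrightarrow> a \<in> X" if "a \<in> nonzero_vectors I" for a
  proof
    assume "\<forall>h\<in>H. poly_eval h a = 0"
    then have "\<forall>f\<in>F. f (\<lambda>i. 1 * a i) = 0"
      using G(2) unfolding H_def by (metis UN_I zero_neq_one)
    then show "a \<in> X" using that by (simp add: F(2) cone_of_def)
  next
    assume "a \<in> X"
    then have "\<forall>f\<in>F. \<forall>c. c \<noteq> 0 \<longrightarrow> f (\<lambda>i. c * a i) = 0"
      using is_coneD[OF cone] F(2) by (auto simp: cone_of_def)
    then show "\<forall>h\<in>H. poly_eval h a = 0" using G(2) unfolding H_def by blast
  qed
  have "lines I X = zero_locus I H"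
  proof
    show "lines I X \<subseteq> zero_locus I H"
      using lines_subset[OF cone] Union_lines[OF cone] iff F(2)
      by (fastforce simp: zero_locus_def cone_of_def)
    show "zero_locus I H \<subseteq> lines I X"
    proof
      fix P assume P: "P \<in> zero_locus I H"
      then have PI: "P \<in> proj_space I" by (simp add: zero_locus_def)
      then have "P \<subseteq> nonzero_vectors I"
        unfolding proj_space_def by (rule in_quotient_imp_subset[OF equiv_proportional])
      then have "P \<subseteq> X" using P iff unfolding zero_locus_def by blast
      then have "lines I P \<subseteq> lines I X" unfolding lines_def by (rule image_mono)
      moreover have "lines I P = {P}" using lines_Union[of "{P}" I] PI by simp
      ultimately show "P \<in> lines I X" by simp
    qed
  qed
  then show ?thesis using H closedin_zariski by blast
qed

lemma alg_cone_Union: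
  assumes "closedin (zariski I) Z"
  shows "alg_cone I (\<Union>Z)"
proof -
  obtain F where F: "F \<subseteq> homogeneous_polys I" "Z = zero_locus I F"
    using assms closedin_zariski by blast
  have ZI: "Z \<subseteq> proj_space I" by (auto simp: F(2) zero_locus_def)
  have eq: "\<Union>Z = cone_of I (poly_eval ` F)"
  proof
    show "\<Union>Z \<subseteq> cone_of I (poly_eval ` F)"
    proof
      fix a assume "a \<in> \<Union>Z"
      then obtain P where P: "P \<in> Z" "a \<in> P" by blast
      have "P \<in> nonzero_vectors I // proportional I" using P(1) ZI by (auto simp: proj_space_def)
      then have "a \<in> nonzero_vectors I"
        using in_quotient_imp_subset[OF equiv_proportional] P(2) by blast
      then show "a \<in> cone_of I (poly_eval ` F)"
        using P by (auto simp: F(2) zero_locus_def cone_of_def)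
    qed
    show "cone_of I (poly_eval ` F) \<subseteq> \<Union>Z"
    proof
      fix a assume a: "a \<in> cone_of I (poly_eval ` F)"
      define P where "P = proportional I `` {a}"
      have "a \<in> nonzero_vectors I" using a by (simp add: cone_of_def)
      then have P: "P \<in> proj_space I" "a \<in> P"
        unfolding P_def proj_space_def by (rule quotientI, rule line_self)
      have "poly_eval f b = 0" if "f \<in> F" "b \<in> P" for f b
        using poly_eval_eq_0_proj_space[of f I P a b] that P a F(1) by (auto simp: cone_of_def)
      then show "a \<in> \<Union>Z" using P by (auto simp: F(2) zero_locus_def)
    qed
  qed
  have "poly_eval ` F \<subseteq> poly_funs I"
    using F(1) by (auto simp: homogeneous_polys_def intro!: poly_funs_poly_eval)
  moreover have "is_cone I (cone_of I (poly_eval ` F))"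
    unfolding is_cone_def cone_of_def
    using F(1) poly_eval_scale_eq_0_iff nonzero_vectors_scale by fastforce
  ultimately show ?thesis unfolding alg_cone_def eq by blast
qed

lemma irreducible_closed_lines:
  assumes "alg_cone I X" "X \<noteq> {}"
    and "\<And>A B. alg_cone I A \<Longrightarrow> alg_cone I B \<Longrightarrow> X = A \<union> B \<Longrightarrow> X = A \<or> X = B"
  shows "irreducible_closed (zariski I) (lines I X)"
  unfolding irreducible_closed_def
proof (intro conjI allI impI)
  show "closedin (zariski I) (lines I X)" using assms(1) by (rule closedin_lines)
  show "lines I X \<noteq> {}" using assms(2) by (simp add: lines_def)
  fix A B assume AB: "closedin (zariski I) A \<and> closedin (zariski I) B \<and> lines I X = A \<union> B"
  have "X = \<Union>A \<union> \<Union>B"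
    using Union_lines[of I X] assms(1) AB by (auto simp: alg_cone_def)
  then have "X = \<Union>A \<or> X = \<Union>B" using assms(3) alg_cone_Union AB by blast
  moreover have "A \<subseteq> proj_space I" "B \<subseteq> proj_space I"
    using AB closedin_subset by fastforce+
  ultimately show "lines I X = A \<or> lines I X = B" using lines_Union by metis
qed

lemma irreducible_closedD:
  assumes "irreducible_closed (zariski I) Z" "alg_cone I A" "alg_cone I B" "\<Union>Z = A \<union> B"
  shows "\<Union>Z = A \<or> \<Union>Z = B"
proof -
  have "Z \<subseteq> proj_space I"
    using assms(1) closedin_subset unfolding irreducible_closed_def by fastforce
  then have "Z = lines I A \<union> lines I B"
    using lines_Union[of Z I] assms(4) by (simp add: lines_def image_Un)
  then have "Z = lines I A \<or> Z = lines I B"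
    using assms(1-3) closedin_lines unfolding irreducible_closed_def by blast
  then show ?thesis using Union_lines assms(2,3) unfolding alg_cone_def by metis
qed

text \<open>Scaling the argument maps the polynomials vanishing on a cone to such polynomials. Their
  common zeros therefore form an algebraic cone, and its lines contain the closure. Allowing
  inhomogeneous \<open>f\<close> later admits translates by multiples of \<open>q\<close>.\<close>

lemma closure_lines_vanish:
  assumes cone: "is_cone I S" and "f \<in> poly_funs I" "\<And>a. a \<in> S \<Longrightarrow> f a = 0"
    and "z \<in> \<Union>((zariski I) closure_of (lines I S))"
  shows "f z = 0"
proof -
  define F where "F = {f \<in> poly_funs I. \<forall>a\<in>S. f a = 0}"
  have "is_cone I (cone_of I F)"
    unfolding is_cone_def
  proof (intro conjI ballI allI impI)
    show "cone_of I F \<subseteq> nonzero_vectors I" by (auto simp: cone_of_def)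
    fix a c assume a: "a \<in> cone_of I F" and c: "(c::complex) \<noteq> 0"
    have "f (\<lambda>i. c * a i) = 0" if "f \<in> F" for f
    proof -
      have "(\<lambda>a. f (\<lambda>i. c * a i)) \<in> F"
        using that poly_funs_affine[of f I c "\<lambda>_. 0"] is_coneD[OF cone _ c] by (simp add: F_def)
      then show ?thesis using a by (auto simp: cone_of_def)
    qed
    then show "(\<lambda>i. c * a i) \<in> cone_of I F"
      using a nonzero_vectors_scale[OF _ c] by (auto simp: cone_of_def)
  qed
  moreover have "F \<subseteq> poly_funs I" by (auto simp: F_def)
  ultimately have alg: "alg_cone I (cone_of I F)" unfolding alg_cone_def by blast
  have "S \<subseteq> cone_of I F" using cone by (auto simp: cone_of_def F_def is_cone_def)
  then have "lines I S \<subseteq> lines I (cone_of I F)" by (auto simp: lines_def)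
  then have "(zariski I) closure_of (lines I S) \<subseteq> lines I (cone_of I F)"
    by (intro closure_of_minimal closedin_lines alg)
  then have "z \<in> cone_of I F"
    using assms(4) Union_lines[of I "cone_of I F"] alg unfolding alg_cone_def by blast
  then show ?thesis using assms(2,3) by (auto simp: cone_of_def F_def)
qed

text \<open>If \<open>A\<close> and \<open>B\<close> were both proper, some equation
  \<open>f\<close> of \<open>A\<close> and some equation \<open>g\<close> of \<open>B\<close> would
  be nonzero at points \<open>a\<close> and \<open>b\<close>. On the line through \<open>a\<close>
  and \<open>b\<close> the product vanishes, so one factor vanishes on the whole line.\<close>

lemma irreducible_closed_proj_space:
  assumes "nonzero_vectors I \<noteq> {}"
  shows "irreducible_closed (zariski I) (lines I (nonzero_vectors I))"
proof (rule irreducible_closed_lines)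
  show "alg_cone I (nonzero_vectors I)"
    unfolding alg_cone_def is_cone_def using nonzero_vectors_scale
    by (auto simp: cone_of_def intro!: exI[of _ "{}"])
  show "nonzero_vectors I \<noteq> {}" by fact
  fix A B assume A: "alg_cone I A" and B: "alg_cone I B" and AB: "nonzero_vectors I = A \<union> B"
  obtain F G where F: "F \<subseteq> poly_funs I" "A = cone_of I F" and G: "G \<subseteq> poly_funs I" "B = cone_of I G"
    using A B by (auto simp: alg_cone_def)
  show "nonzero_vectors I = A \<or> nonzero_vectors I = B"
  proof (rule ccontr)
    assume neg: "\<not> ?thesis"
    have "A \<subset> nonzero_vectors I" "B \<subset> nonzero_vectors I" using neg AB by blast+
    then obtain a b where "a \<in> nonzero_vectors I" "a \<notin> A" "b \<in> nonzero_vectors I" "b \<notin> B" by blast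
    then obtain f g where a: "a \<in> nonzero_vectors I" "f \<in> F" "f a \<noteq> 0"
      and b: "b \<in> nonzero_vectors I" "g \<in> G" "g b \<noteq> 0"
      unfolding F(2) G(2) cone_of_def by blast
    have f: "f \<in> poly_funs I" and g: "g \<in> poly_funs I" using a b F G by auto
    have *: "f v * g v = 0" if "v \<in> nonzero_vectors I" for v
    proof -
      have "v \<in> A \<or> v \<in> B" using that AB by blast
      then have "f v = 0 \<or> g v = 0" unfolding F(2) G(2) cone_of_def using a(2) b(2) by blast
      then show ?thesis by simp
    qed
    \<comment> \<open>The line from \<open>a\<close> to \<open>b\<close> may pass through the
      origin, which represents no projective point; there the product vanishes as a limit along the
      line through \<open>a\<close>.\<close>
    have **: "f v * g v = 0" if "v \<in> coord_space I" for v
    proof (cases "v = (\<lambda>_. 0)")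
      case True
      have "(\<lambda>i. v i + t * a i) \<in> nonzero_vectors I" if "t \<noteq> 0" for t
        using nonzero_vectors_scale[OF a(1) that] True by simp
      then show ?thesis
        using poly_funs_line_eq_0[OF poly_funs.mult[OF f g], of v a] * by blast
    next
      case False
      then show ?thesis using * that by (simp add: nonzero_vectors_def)
    qed
    have "(\<lambda>i. a i + t * (b i - a i)) \<in> coord_space I" for t
      using a(1) b(1) by (auto simp: nonzero_vectors_def coord_space_def)
    then have "f (\<lambda>i. a i + t * (b i - a i)) = 0 \<or> g (\<lambda>i. a i + t * (b i - a i)) = 0" for t
      using ** by (metis mult_eq_0_iff)
    then have "(\<forall>t. f (\<lambda>i. a i + t * (b i - a i)) = 0) \<or> (\<forall>t. g (\<lambda>i. a i + t * (b i - a i)) = 0)"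
      by (rule poly_funs_line_mult_eq_0[OF f g, of a "\<lambda>i. b i - a i"])
    then have "f (\<lambda>i. a i + 0 * (b i - a i)) = 0 \<or> g (\<lambda>i. a i + 1 * (b i - a i)) = 0" by blast
    then show False using a(3) b(3) by simp
  qed
qed

text \<open>The chain above \<open>Z\<close> consists of the closed join of \<open>Z\<close> with the point \<open>q\<close> and of the whole space.
  The polynomial \<open>R\<close> bounds the join of the degenerate set with \<open>q\<close>, hence also that of \<open>Z\<close>.\<close>

lemma codimension_ge_2:
  fixes I :: "'i set"
  assumes cone: "is_cone I S"
    and p: "p \<in> nonzero_vectors I" and q: "q \<in> nonzero_vectors I"
    and G: "G \<in> poly_funs I" "\<And>a. a \<in> S \<Longrightarrow> G a = 0" "G q \<noteq> 0"
    and R: "R \<in> poly_funs I" "\<And>a t. a \<in> coord_space I \<Longrightarrow> (\<lambda>i. a i + t * q i) \<in> S \<Longrightarrow> R a = 0" "R p \<noteq> 0"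
  shows "codimension (zariski I) (lines I S) \<ge> 2"
  unfolding codimension_def
proof (rule INF_greatest)
  fix Z assume "Z \<in> {Z. irreducible_closed (zariski I) Z \<and> Z \<subseteq> zariski I closure_of lines I S}"
  then have irr: "irreducible_closed (zariski I) Z" and ZS: "Z \<subseteq> zariski I closure_of lines I S"
    by auto
  have Zclosed: "closedin (zariski I) Z" and "Z \<noteq> {}" using irr by (auto simp: irreducible_closed_def)
  have ZI: "Z \<subseteq> proj_space I" using closedin_subset[OF Zclosed] by simp
  define X where "X = \<Union>Z"
  have X: "alg_cone I X" unfolding X_def by (rule alg_cone_Union[OF Zclosed])
  then obtain FX where FX: "FX \<subseteq> poly_funs I" "X = cone_of I FX" and Xcone: "is_cone I X"
    by (auto simp: alg_cone_def)
  have Xnz: "X \<subseteq> nonzero_vectors I" using Xcone by (simp add: is_cone_def)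
  have Xvanish: "f z = 0" if "f \<in> poly_funs I" "\<And>a. a \<in> S \<Longrightarrow> f a = 0" "z \<in> X" for f z
    using closure_lines_vanish[OF cone that(1,2)] that(3) ZS unfolding X_def by blast
  have Xne: "X \<noteq> {}"
    using \<open>Z \<noteq> {}\<close> ZI in_quotient_imp_non_empty[OF equiv_proportional] unfolding X_def proj_space_def
    by (metis Sup_bot_conv(1) all_not_in_conv subsetD)
  have q_notin: "q \<notin> X" using Xvanish[OF G(1,2)] G(3) by blast
  \<comment> \<open>\<open>J\<close> is the ideal of the union of the affine lines z + t q with
    \<open>z\<close> in \<open>X\<close>. Its common zeros form the closed join and include
    \<open>q\<close>, which lies on none of these lines.\<close>
  define J where "J = {f \<in> poly_funs I. \<forall>z\<in>X. \<forall>t. f (\<lambda>i. z i + t * q i) = 0}"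
  define Y where "Y = cone_of I J"
  have join_nz: "(\<lambda>i. z i + t * q i) \<in> nonzero_vectors I" if z: "z \<in> X" for z t
  proof -
    have "(\<lambda>i. z i + t * q i) \<noteq> (\<lambda>_. 0)"
    proof
      assume eq: "(\<lambda>i. z i + t * q i) = (\<lambda>_. 0)"
      have "z \<noteq> (\<lambda>_. 0)" using z Xnz by (auto simp: nonzero_vectors_def)
      then have t: "t \<noteq> 0" using eq by auto
      have "q = (\<lambda>i. (- inverse t) * z i)"
      proof
        fix i
        have "z i = - (t * q i)" using fun_cong[OF eq, of i] by (simp add: add_eq_0_iff2)
        then show "q i = (- inverse t) * z i" using t by simp
      qed
      then have "q \<in> X" using is_coneD[OF Xcone z, of "- inverse t"] t by simp
      then show False using q_notin by simp
    qed
    moreover have "(\<lambda>i. z i + t * q i) \<in> coord_space I"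
      using z Xnz q by (auto simp: nonzero_vectors_def coord_space_def)
    ultimately show ?thesis by (simp add: nonzero_vectors_def)
  qed
  have join: "(\<lambda>i. z i + t * q i) \<in> Y" if "z \<in> X" for z t
    using join_nz[OF that] that by (auto simp: Y_def cone_of_def J_def)
  have J_scale: "(\<lambda>a. f (\<lambda>i. c * a i)) \<in> J" if "f \<in> J" "c \<noteq> 0" for f c
  proof -
    have "f (\<lambda>i. c * (z i + t * q i)) = 0" if "z \<in> X" for z t
    proof -
      have "f (\<lambda>i. c * z i + (c * t) * q i) = 0"
        using \<open>f \<in> J\<close> is_coneD[OF Xcone that \<open>c \<noteq> 0\<close>] unfolding J_def mem_Collect_eq by metis
      then show ?thesis by (simp add: distrib_left mult.assoc)
    qed
    then show ?thesis
      using that(1) poly_funs_affine[of f I c "\<lambda>_. 0"] by (simp add: J_def)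
  qed
  have Ycone: "is_cone I Y"
    unfolding is_cone_def
  proof (intro conjI ballI allI impI)
    show "Y \<subseteq> nonzero_vectors I" by (auto simp: cone_of_def Y_def)
    fix a c assume a: "a \<in> Y" and c: "(c::complex) \<noteq> 0"
    then have nz: "a \<in> nonzero_vectors I" and vanish: "\<And>f. f \<in> J \<Longrightarrow> f a = 0"
      by (auto simp: cone_of_def Y_def)
    have "f (\<lambda>i. c * a i) = 0" if "f \<in> J" for f
      by (rule vanish[OF J_scale[OF that c]])
    then show "(\<lambda>i. c * a i) \<in> Y"
      using nonzero_vectors_scale[OF nz c] by (simp add: cone_of_def Y_def)
  qed
  have "J \<subseteq> poly_funs I" by (auto simp: J_def)
  then have Y: "alg_cone I Y" using Ycone Y_def unfolding alg_cone_def by blast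
  have XY: "X \<subseteq> Y" using join[of _ 0] by auto
  have qY: "q \<in> Y"
  proof -
    obtain z where z: "z \<in> X" using Xne by blast
    \<comment> \<open>The point q + c z is \<open>c\<close> times a point of the join when
      \<open>c\<close> is nonzero, and it tends to \<open>q\<close> as \<open>c\<close> tends to
      0.\<close>
    have "f q = 0" if f: "f \<in> J" for f
    proof (rule poly_funs_line_eq_0[of f I q z])
      show "f \<in> poly_funs I" using f by (simp add: J_def)
      fix c :: complex assume c: "c \<noteq> 0"
      have "f (\<lambda>i. c * (z i + inverse c * q i)) = 0"
        using J_scale[OF f c] z unfolding J_def by blast
      then show "f (\<lambda>i. q i + c * z i) = 0"
        using c by (simp add: distrib_left mult.assoc[symmetric] add.commute)
    qed
    then show ?thesis using q by (auto simp: Y_def cone_of_def)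
  qed
  have "R \<in> J"
  proof -
    have "R (\<lambda>i. z i + t * q i) = 0" if "z \<in> X" for z t
    proof -
      \<comment> \<open>\<open>R(2)\<close> speaks of points of \<open>S\<close>, while
        \<open>z\<close> lies only in the closure. The translate of \<open>R\<close> by
        \<open>t * q\<close> vanishes on \<open>S\<close>, because subtracting \<open>t * q\<close>
        leads back to \<open>S\<close>; being polynomial, it also vanishes on \<open>X\<close>. The
        factor 1 matches the shape of \<open>poly_funs_affine\<close>.\<close>
      have "(\<lambda>a. R (\<lambda>i. 1 * a i + t * q i)) \<in> poly_funs I"
        by (rule poly_funs_affine[OF R(1)])
      moreover have "R (\<lambda>i. 1 * a i + t * q i) = 0" if "a \<in> S" for a
      proof (rule R(2))
        show "(\<lambda>i. 1 * a i + t * q i) \<in> coord_space I"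
          using that cone q by (auto simp: is_cone_def nonzero_vectors_def coord_space_def)
        show "(\<lambda>i. 1 * a i + t * q i + (- t) * q i) \<in> S" using that by simp
      qed
      ultimately show ?thesis using Xvanish[of "\<lambda>a. R (\<lambda>i. 1 * a i + t * q i)" z] that by simp
    qed
    then show ?thesis using R(1) by (simp add: J_def)
  qed
  then have pY: "p \<notin> Y" using R(3) by (auto simp: Y_def cone_of_def)
  have Yirr: "irreducible_closed (zariski I) (lines I Y)"
  proof (rule irreducible_closed_lines[OF Y])
    show "Y \<noteq> {}" using qY by blast
    fix A B assume A: "alg_cone I A" and B: "alg_cone I B" and AB: "Y = A \<union> B"
    obtain FA where FA: "FA \<subseteq> poly_funs I" "A = cone_of I FA" "is_cone I A"
      using A by (auto simp: alg_cone_def)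
    obtain FB where FB: "FB \<subseteq> poly_funs I" "B = cone_of I FB" "is_cone I B"
      using B by (auto simp: alg_cone_def)
    \<comment> \<open>\<open>T C\<close> collects the points of \<open>X\<close> whose whole line
      towards \<open>q\<close> lies in \<open>C\<close>. Each such line is irreducible, so it lies
      in \<open>A\<close> or in \<open>B\<close>, and irreducibility of \<open>X\<close> makes the
      choice uniform. The equations of the chosen set then vanish on the join and belong to
      \<open>J\<close>.\<close>
    define T where "T C = {z \<in> X. \<forall>t. (\<lambda>i. z i + t * q i) \<in> C}" for C
    have T_alg: "alg_cone I (T C)" if C: "F \<subseteq> poly_funs I" "C = cone_of I F" "is_cone I C" for C F
    proof -
      define F' where "F' = FX \<union> {(\<lambda>a. f (\<lambda>i. 1 * a i + t * q i)) |f t. f \<in> F}"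
      have "(\<lambda>a. f (\<lambda>i. 1 * a i + t * q i)) \<in> poly_funs I" if "f \<in> F" for f t
        using that C(1) by (intro poly_funs_affine) blast
      then have "F' \<subseteq> poly_funs I" using FX(1) unfolding F'_def by blast
      moreover have "T C = cone_of I F'"
      proof -
        have "(\<lambda>i. z i + t * q i) \<in> C \<longleftrightarrow> (\<forall>f\<in>F. f (\<lambda>i. z i + t * q i) = 0)" if "z \<in> X" for z t
          using join_nz[OF that, of t] unfolding C(2) cone_of_def by blast
        then have "T C = {z \<in> X. \<forall>t. \<forall>f\<in>F. f (\<lambda>i. z i + t * q i) = 0}"
          unfolding T_def by blast
        also have "\<dots> = cone_of I F'"
          unfolding F'_def FX(2) cone_of_def by (simp add: ball_Un) blast
        finally show ?thesis .
      qed
      moreover have "is_cone I (T C)"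
        unfolding is_cone_def
      proof (intro conjI ballI allI impI)
        show "T C \<subseteq> nonzero_vectors I" using Xnz by (auto simp: T_def)
        fix z c assume z: "z \<in> T C" and c: "(c::complex) \<noteq> 0"
        have "(\<lambda>i. c * z i + t * q i) \<in> C" for t
        proof -
          have "(\<lambda>i. z i + (t / c) * q i) \<in> C" using z unfolding T_def by blast
          from is_coneD[OF C(3) this c] have "(\<lambda>i. c * (z i + (t / c) * q i)) \<in> C" .
          moreover have "(\<lambda>i. c * (z i + (t / c) * q i)) = (\<lambda>i. c * z i + t * q i)"
            using c by (auto simp: field_simps)
          ultimately show ?thesis by simp
        qed
        then show "(\<lambda>i. c * z i) \<in> T C"
          using z is_coneD[OF Xcone _ c] by (auto simp: T_def)
      qed
      ultimately show ?thesis unfolding alg_cone_def by blast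
    qed
    have "X = T A \<union> T B"
    proof
      show "T A \<union> T B \<subseteq> X" by (auto simp: T_def)
      show "X \<subseteq> T A \<union> T B"
      proof (rule subsetI, rule ccontr)
        fix z assume z: "z \<in> X" and "z \<notin> T A \<union> T B"
        then obtain t u where "(\<lambda>i. z i + t * q i) \<notin> A" "(\<lambda>i. z i + u * q i) \<notin> B"
          unfolding T_def by blast
        then obtain f g where f: "f \<in> FA" "f (\<lambda>i. z i + t * q i) \<noteq> 0"
          and g: "g \<in> FB" "g (\<lambda>i. z i + u * q i) \<noteq> 0"
          using join_nz[OF z, of t] join_nz[OF z, of u] unfolding FA(2) FB(2) cone_of_def by blast
        have "f (\<lambda>i. z i + v * q i) = 0 \<or> g (\<lambda>i. z i + v * q i) = 0" for v
        proof -
          have "(\<lambda>i. z i + v * q i) \<in> A \<or> (\<lambda>i. z i + v * q i) \<in> B"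
            using join[OF z, of v] AB by blast
          then show ?thesis unfolding FA(2) FB(2) cone_of_def using f(1) g(1) by blast
        qed
        then show False
          using poly_funs_line_mult_eq_0[of f I g z q] f g FA(1) FB(1) by blast
      qed
    qed
    then have "X = T A \<or> X = T B"
      using irreducible_closedD[OF irr T_alg[OF FA] T_alg[OF FB]] by (simp add: X_def)
    moreover have "Y \<subseteq> C" if "X = T C" "F \<subseteq> poly_funs I" "C = cone_of I F" for C F
    proof -
      have "f (\<lambda>i. z i + t * q i) = 0" if "f \<in> F" "z \<in> X" for f z t
      proof -
        have "(\<lambda>i. z i + t * q i) \<in> C" using \<open>z \<in> X\<close> \<open>X = T C\<close> unfolding T_def by blast
        then show ?thesis using that(1) unfolding \<open>C = cone_of I F\<close> cone_of_def by blast
      qed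
      then have "F \<subseteq> J" using that(2) unfolding J_def by blast
      then show ?thesis unfolding Y_def that(3) cone_of_def by blast
    qed
    ultimately show "Y = A \<or> Y = B" using FA FB AB by blast
  qed
  define C where "C k = (if k = 0 then Z else if k = 1 then lines I Y else lines I (nonzero_vectors I))"
    for k :: nat
  have ncone: "is_cone I (nonzero_vectors I)" using nonzero_vectors_scale by (auto simp: is_cone_def)
  have "Z \<subset> lines I Y"
  proof -
    have "Z = lines I X" using lines_Union[OF ZI] by (simp add: X_def)
    then show ?thesis using lines_strict_mono[OF Xcone Ycone] XY qY q_notin by blast
  qed
  moreover have "lines I Y \<subset> lines I (nonzero_vectors I)"
  proof -
    have "Y \<subseteq> nonzero_vectors I" using Ycone by (simp add: is_cone_def)
    then show ?thesis using lines_strict_mono[OF Ycone ncone] p pY by blast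
  qed
  moreover have "irreducible_closed (zariski I) (lines I (nonzero_vectors I))"
    using p by (intro irreducible_closed_proj_space) auto
  ultimately have "(\<forall>i\<le>2. irreducible_closed (zariski I) (C i)) \<and> (\<forall>i<2. C i \<subset> C (Suc i))"
    using irr Yirr by (auto simp: C_def less_2_cases_iff)
  moreover have "C 0 = Z" by (simp add: C_def)
  ultimately have "enat 2 \<le> irreducible_codim (zariski I) Z"
    unfolding irreducible_codim_def by (intro SUP_upper) blast
  then show "2 \<le> irreducible_codim (zariski I) Z" by (simp add: numeral_eq_enat)
qed

section \<open>Determinants over finite index sets\<close>

text \<open>The matrices below are indexed by monomials. Any numbering serves: a change permutes
  rows and columns alike and preserves the determinant.\<close>

definition enum_of :: "'s set \<Rightarrow> nat \<Rightarrow> 's" where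
  "enum_of S = (SOME e. bij_betw e {0..<card S} S)"

lemma enum_of_bij: "finite S \<Longrightarrow> bij_betw (enum_of S) {0..<card S} S"
  unfolding enum_of_def by (rule someI_ex[OF ex_bij_betw_nat_finite])

lemma enum_of_in: "finite S \<Longrightarrow> i < card S \<Longrightarrow> enum_of S i \<in> S"
  using enum_of_bij[of S] by (auto simp: bij_betw_def)

lemma sum_enum_of: "finite S \<Longrightarrow> (\<Sum>j\<in>S. f j) = (\<Sum>j = 0..<card S. f (enum_of S j))"
  by (rule sum.reindex_bij_betw[OF enum_of_bij, symmetric])

lemma enum_of_surj: "finite S \<Longrightarrow> s \<in> S \<Longrightarrow> \<exists>i<card S. s = enum_of S i"
  using enum_of_bij[of S] unfolding bij_betw_def by (metis atLeastLessThan_iff imageE)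

definition fmat :: "'s set \<Rightarrow> ('s \<Rightarrow> 's \<Rightarrow> complex) \<Rightarrow> complex mat" where
  "fmat S M = Matrix.mat (card S) (card S) (\<lambda>(i, j). M (enum_of S i) (enum_of S j))"

definition fdet :: "'s set \<Rightarrow> ('s \<Rightarrow> 's \<Rightarrow> complex) \<Rightarrow> complex" where
  "fdet S M = Determinant.det (fmat S M)"

lemma fdet_cong:
  assumes "finite S" "\<And>i j. i \<in> S \<Longrightarrow> j \<in> S \<Longrightarrow> M i j = M' i j"
  shows "fdet S M = fdet S M'"
proof -
  have "fmat S M = fmat S M'"
    unfolding fmat_def using assms enum_of_in[of S] by (intro cong_mat) auto
  then show ?thesis by (simp add: fdet_def)
qed

lemma fmat_carrier: "fmat S M \<in> carrier_mat (card S) (card S)"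
  by (simp add: fmat_def)

lemma fmat_mult_vec:
  assumes "finite S" "v \<in> carrier_vec (card S)" "i < card S"
    and "\<And>j. j < card S \<Longrightarrow> vec_index v j = w (enum_of S j)"
  shows "vec_index (fmat S M *\<^sub>v v) i = (\<Sum>s\<in>S. M (enum_of S i) s * w s)"
proof -
  have "vec_index (fmat S M *\<^sub>v v) i =
      (\<Sum>j = 0..<card S. M (enum_of S i) (enum_of S j) * vec_index v j)"
    using assms(2,3) by (simp add: fmat_def scalar_prod_def)
  also have "\<dots> = (\<Sum>s\<in>S. M (enum_of S i) s * w s)"
    unfolding sum_enum_of[OF assms(1)] using assms(4) by (intro sum.cong refl) simp
  finally show ?thesis .
qed

lemma ex_fun_of_vec:
  assumes "finite S"
  shows "\<exists>w. \<forall>j < card S. vec_index v j = w (enum_of S j)"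
proof -
  have "inv_into {0..<card S} (enum_of S) (enum_of S j) = j" if "j < card S" for j
    using enum_of_bij[OF assms] that by (simp add: bij_betw_def inv_into_f_f)
  then show ?thesis
    by (intro exI[of _ "\<lambda>s. vec_index v (inv_into {0..<card S} (enum_of S) s)"]) simp
qed

lemma fdet_eq_0_iff:
  assumes S: "finite S"
  shows "fdet S M = 0 \<longleftrightarrow> (\<exists>w. (\<exists>i\<in>S. w i \<noteq> 0) \<and> (\<forall>i\<in>S. (\<Sum>j\<in>S. M i j * w j) = 0))"
proof
  assume "fdet S M = 0"
  then obtain v where v: "v \<in> carrier_vec (card S)" "v \<noteq> 0\<^sub>v (card S)" "fmat S M *\<^sub>v v = 0\<^sub>v (card S)"
    using det_0_iff_vec_prod_zero[OF fmat_carrier] by (auto simp: fdet_def)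
  obtain w where w: "\<And>j. j < card S \<Longrightarrow> vec_index v j = w (enum_of S j)"
    using ex_fun_of_vec[OF S] by blast
  have "\<exists>i<card S. vec_index v i \<noteq> 0"
    using v(1,2) by (auto simp: vec_eq_iff)
  then have "\<exists>i\<in>S. w i \<noteq> 0" using w enum_of_in[OF S] by metis
  moreover have "(\<Sum>j\<in>S. M i j * w j) = 0" if i: "i \<in> S" for i
  proof -
    obtain k where k: "k < card S" "i = enum_of S k" using enum_of_surj[OF S i] by blast
    then show ?thesis using fmat_mult_vec[OF S v(1) k(1) w, of M] v(3) by simp
  qed
  ultimately show "\<exists>w. (\<exists>i\<in>S. w i \<noteq> 0) \<and> (\<forall>i\<in>S. (\<Sum>j\<in>S. M i j * w j) = 0)" by blast
next
  assume "\<exists>w. (\<exists>i\<in>S. w i \<noteq> 0) \<and> (\<forall>i\<in>S. (\<Sum>j\<in>S. M i j * w j) = 0)"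
  then obtain w i where w: "i \<in> S" "w i \<noteq> 0" "\<And>i. i \<in> S \<Longrightarrow> (\<Sum>j\<in>S. M i j * w j) = 0" by blast
  define v where "v = Matrix.vec (card S) (\<lambda>i. w (enum_of S i))"
  have v: "v \<in> carrier_vec (card S)" "\<And>j. j < card S \<Longrightarrow> vec_index v j = w (enum_of S j)"
    by (auto simp: v_def)
  obtain k where k: "k < card S" "i = enum_of S k" using enum_of_surj[OF S w(1)] by blast
  have "v \<noteq> 0\<^sub>v (card S)"
    using v(2)[OF k(1)] w(2) k by auto
  moreover have "fmat S M *\<^sub>v v = 0\<^sub>v (card S)"
  proof (rule eq_vecI)
    fix i assume "i < dim_vec (0\<^sub>v (card S) :: complex Matrix.vec)"
    then have i: "i < card S" by simp
    show "vec_index (fmat S M *\<^sub>v v) i = vec_index (0\<^sub>v (card S)) i"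
      using fmat_mult_vec[OF S v(1) i v(2), of M] w(3)[OF enum_of_in[OF S i]] i by simp
  qed (simp add: fmat_def)
  ultimately show "fdet S M = 0"
    using v(1) det_0_iff_vec_prod_zero[OF fmat_carrier] unfolding fdet_def by blast
qed

lemma fdet_scalar_nonzero:
  assumes "finite S" "c \<noteq> 0"
  shows "fdet S (\<lambda>i j. if i = j then c else 0) \<noteq> 0"
proof -
  have "(\<Sum>j\<in>S. (if i = j then c else 0) * w j) = c * w i" if "i \<in> S" for i w
    using that assms(1) by (simp add: if_distrib[of "\<lambda>x. x * _"] sum.delta cong: if_cong)
  then show ?thesis using assms by (auto simp: fdet_eq_0_iff)
qed

lemma fdet_inverse:
  assumes S: "finite S" and "fdet S M \<noteq> 0"
  shows "\<exists>N. \<forall>i\<in>S. \<forall>k\<in>S. (\<Sum>j\<in>S. N i j * M j k) = (if i = k then 1 else 0)"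
proof -
  let ?c = "card S"
  have "fmat S M \<in> Units (ring_mat TYPE(complex) ?c ())"
    using det_non_zero_imp_unit[OF fmat_carrier] assms(2) by (simp add: fdet_def)
  then obtain B where B: "B \<in> carrier_mat ?c ?c" "B * fmat S M = 1\<^sub>m ?c"
    by (auto simp: Units_def ring_mat_def)
  define ix where "ix = inv_into {0..<?c} (enum_of S)"
  have ix: "ix (enum_of S i) = i" if "i < ?c" for i
    using enum_of_bij[OF S] that by (auto simp: ix_def bij_betw_def inv_into_f_f)
  have ix': "ix s < ?c" "enum_of S (ix s) = s" if "s \<in> S" for s
    using enum_of_surj[OF S that] ix by auto
  have "(\<Sum>j\<in>S. B $$ (ix i, ix j) * M j k) = (if i = k then 1 else 0)" if "i \<in> S" "k \<in> S" for i k
  proof -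
    have "(\<Sum>j\<in>S. B $$ (ix i, ix j) * M j k) =
        (\<Sum>j = 0..<?c. B $$ (ix i, j) * fmat S M $$ (j, ix k))"
      unfolding sum_enum_of[OF S] using ix'[OF that(2)]
      by (intro sum.cong refl) (simp add: fmat_def ix)
    also have "\<dots> = (B * fmat S M) $$ (ix i, ix k)"
      using B(1) ix'(1)[OF that(1)] ix'(1)[OF that(2)] fmat_carrier[of S M]
      by (simp add: scalar_prod_def)
    also have "\<dots> = (if i = k then 1 else 0)"
    proof -
      have "ix i = ix k \<longleftrightarrow> i = k" using ix'(2) that by metis
      then show ?thesis unfolding B(2) using ix'(1) that by simp
    qed
    finally show ?thesis .
  qed
  then show ?thesis by (intro exI[of _ "\<lambda>i j. B $$ (ix i, ix j)"]) blast
qed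

lemma finite_eigenvalues:
  fixes T :: "'s \<Rightarrow> 's \<Rightarrow> complex"
  assumes S: "finite S"
  shows "finite {z. \<exists>w. (\<exists>i\<in>S. w i \<noteq> 0) \<and> (\<forall>i\<in>S. (\<Sum>j\<in>S. T i j * w j) = z * w i)}"
proof (rule finite_subset)
  show "finite (spectrum (fmat S T))" by (rule card_finite_spectrum[OF fmat_carrier])
  show "{z. \<exists>w. (\<exists>i\<in>S. w i \<noteq> 0) \<and> (\<forall>i\<in>S. (\<Sum>j\<in>S. T i j * w j) = z * w i)} \<subseteq> spectrum (fmat S T)"
  proof
    fix z assume "z \<in> {z. \<exists>w. (\<exists>i\<in>S. w i \<noteq> 0) \<and> (\<forall>i\<in>S. (\<Sum>j\<in>S. T i j * w j) = z * w i)}"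
    then obtain w i where w: "i \<in> S" "w i \<noteq> 0" "\<And>i. i \<in> S \<Longrightarrow> (\<Sum>j\<in>S. T i j * w j) = z * w i"
      by blast
    define v where "v = Matrix.vec (card S) (\<lambda>i. w (enum_of S i))"
    have v: "v \<in> carrier_vec (card S)" "\<And>j. j < card S \<Longrightarrow> vec_index v j = w (enum_of S j)"
      by (auto simp: v_def)
    obtain k where k: "k < card S" "i = enum_of S k" using enum_of_surj[OF S w(1)] by blast
    have "v \<noteq> 0\<^sub>v (card S)" using v(2)[OF k(1)] w(2) k by auto
    moreover have "fmat S T *\<^sub>v v = z \<cdot>\<^sub>v v"
    proof (rule eq_vecI)
      fix i assume "i < dim_vec (z \<cdot>\<^sub>v v)"
      then have i: "i < card S" using v(1) by simp
      show "vec_index (fmat S T *\<^sub>v v) i = vec_index (z \<cdot>\<^sub>v v) i"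
        using fmat_mult_vec[OF S v(1) i v(2), of T] w(3)[OF enum_of_in[OF S i]] i v by simp
    qed (use v in \<open>simp add: fmat_def\<close>)
    ultimately show "z \<in> spectrum (fmat S T)"
      using v(1) fmat_carrier[of S T] unfolding spectrum_def eigenvalue_def eigenvector_def by auto
  qed
qed

text \<open>The Leibniz formula uses only sums and products. The general form covers determinants
  over \<open>poly_funs\<close> as well as over \<open>param_polys\<close>.\<close>

lemma fdet_in_fun_algebra:
  assumes R: "fun_algebra R" and S: "finite S"
    and M: "\<And>i j. i \<in> S \<Longrightarrow> j \<in> S \<Longrightarrow> (\<lambda>w. M w i j) \<in> R"
  shows "(\<lambda>w. fdet S (M w)) \<in> R"
proof -
  let ?n = "card S"
  have "(\<lambda>w. fdet S (M w)) = (\<lambda>w. \<Sum>p\<in>{p. p permutes {0..<?n}}. signof p *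
      (\<Prod>i\<in>{0..<?n}. M w (enum_of S i) (enum_of S (p i))))"
  proof
    fix w
    show "fdet S (M w) = (\<Sum>p\<in>{p. p permutes {0..<?n}}. signof p *
      (\<Prod>i\<in>{0..<?n}. M w (enum_of S i) (enum_of S (p i))))"
      unfolding fdet_def det_def'[OF fmat_carrier]
      by (intro sum.cong refl arg_cong2[where f = "(*)"] prod.cong)
        (auto simp: fmat_def dest: permutes_in_image)
  qed
  also have "\<dots> \<in> R"
  proof (intro fun_algebra_sum[OF R] fun_algebraD(3)[OF R] fun_algebraD(1)[OF R]
        fun_algebra_prod[OF R] M enum_of_in[OF S])
    fix p i assume "p \<in> {p. p permutes {0..<?n}}" "i \<in> {0..<?n}"
    then show "i < ?n" "p i < ?n" using permutes_in_image[of p "{0..<?n}" i] by auto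
  qed
  finally show ?thesis .
qed

section \<open>Elimination of a parameter\<close>

text \<open>Polynomials in the parameter with coefficients in \<open>poly_funs I\<close>. The degree
  bound \<open>D\<close>, uniform in \<open>a\<close>, makes the substitution of a matrix for the
  parameter a sum of fixed length, hence polynomial in \<open>a\<close>.\<close>

definition param_polys :: "'i set \<Rightarrow> (('i \<Rightarrow> complex) \<times> complex \<Rightarrow> complex) set" where
  "param_polys I = {\<phi>. \<exists>g D. (\<forall>a. degree (g a) \<le> D) \<and> (\<forall>k. (\<lambda>a. coeff (g a) k) \<in> poly_funs I) \<and>
     (\<forall>a t. \<phi> (a, t) = poly (g a) t)}"

lemma param_polysI:
  assumes "\<And>a. degree (g a) \<le> D" "\<And>k. (\<lambda>a. coeff (g a) k) \<in> poly_funs I"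
    and "\<And>a t. \<phi> (a, t) = poly (g a) t"
  shows "\<phi> \<in> param_polys I"
  unfolding param_polys_def using assms by blast

lemma param_polysD:
  "\<phi> \<in> param_polys I \<Longrightarrow> \<exists>g D. (\<forall>a. degree (g a) \<le> D) \<and>
     (\<forall>k. (\<lambda>a. coeff (g a) k) \<in> poly_funs I) \<and> (\<forall>a t. \<phi> (a, t) = poly (g a) t)"
  by (simp add: param_polys_def)

lemma param_polys_fst: "f \<in> poly_funs I \<Longrightarrow> (\<lambda>w. f (fst w)) \<in> param_polys I"
proof (rule param_polysI[of "\<lambda>a. [:f a:]" 0])
  fix k assume "f \<in> poly_funs I"
  then show "(\<lambda>a. coeff [:f a:] k) \<in> poly_funs I"
    by (cases k) (auto intro: poly_funs.const)
qed auto

lemma param_polys_snd: "snd \<in> param_polys I"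
  by (rule param_polysI[of "\<lambda>a. [:0, 1:]" 1]) (auto intro: poly_funs.const)

lemma fun_algebra_param_polys: "fun_algebra (param_polys I)"
  unfolding fun_algebra_def
proof (intro conjI allI ballI)
  show "(\<lambda>_. c) \<in> param_polys I" for c
    using param_polys_fst[OF poly_funs.const, of c I] by simp
  fix f g assume f: "f \<in> param_polys I" and g: "g \<in> param_polys I"
  obtain F D where F: "\<And>a. degree (F a) \<le> D" "\<And>k. (\<lambda>a. coeff (F a) k) \<in> poly_funs I"
    "\<And>a t. f (a, t) = poly (F a) t" using param_polysD[OF f] by blast
  obtain G E where G: "\<And>a. degree (G a) \<le> E" "\<And>k. (\<lambda>a. coeff (G a) k) \<in> poly_funs I"
    "\<And>a t. g (a, t) = poly (G a) t" using param_polysD[OF g] by blast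
  show "(\<lambda>w. f w + g w) \<in> param_polys I"
  proof (rule param_polysI[of "\<lambda>a. F a + G a" "max D E"])
    show "degree (F a + G a) \<le> max D E" for a
      using F(1)[of a] G(1)[of a] by (intro degree_add_le) auto
  qed (auto simp: F(3) G(3) intro: poly_funs.add F(2) G(2))
  show "(\<lambda>w. f w * g w) \<in> param_polys I"
  proof (rule param_polysI[of "\<lambda>a. F a * G a" "D + E"])
    show "degree (F a * G a) \<le> D + E" for a
      using F(1)[of a] G(1)[of a] degree_mult_le[of "F a" "G a"] by linarith
    show "(\<lambda>a. coeff (F a * G a) k) \<in> poly_funs I" for k
      unfolding coeff_mult by (intro poly_funs_sum poly_funs.mult F(2) G(2))
  qed (auto simp: F(3) G(3))
qed

primrec fpow :: "'s set \<Rightarrow> ('s \<Rightarrow> 's \<Rightarrow> complex) \<Rightarrow> nat \<Rightarrow> 's \<Rightarrow> 's \<Rightarrow> complex" where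
  "fpow S M 0 = (\<lambda>i j. if i = j then 1 else 0)"
| "fpow S M (Suc k) = (\<lambda>i j. \<Sum>l\<in>S. M i l * fpow S M k l j)"

lemma fpow_eigenvector:
  assumes "finite S" "\<And>i. i \<in> S \<Longrightarrow> (\<Sum>j\<in>S. M i j * w j) = t * w i" "i \<in> S"
  shows "(\<Sum>j\<in>S. fpow S M k i j * w j) = t ^ k * w i"
  using assms(3)
proof (induction k arbitrary: i)
  case 0
  then show ?case
    using assms(1) by (simp add: if_distrib[of "\<lambda>x. x * _"] sum.delta cong: if_cong)
next
  case (Suc k)
  have "(\<Sum>j\<in>S. fpow S M (Suc k) i j * w j) = (\<Sum>j\<in>S. \<Sum>l\<in>S. M i l * (fpow S M k l j * w j))"
    by (simp add: sum_distrib_right mult.assoc)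
  also have "\<dots> = (\<Sum>l\<in>S. \<Sum>j\<in>S. M i l * (fpow S M k l j * w j))"
    by (rule sum.swap)
  also have "\<dots> = (\<Sum>l\<in>S. M i l * (t ^ k * w l))"
    by (simp add: sum_distrib_left[symmetric] Suc.IH)
  also have "\<dots> = t ^ k * (\<Sum>l\<in>S. M i l * w l)"
    by (simp add: sum_distrib_left mult_ac)
  finally show ?case using assms(2)[OF Suc.prems] by simp
qed

lemma poly_funs_fpow:
  assumes "\<And>i j. i \<in> S \<Longrightarrow> j \<in> S \<Longrightarrow> \<kappa> i j \<in> poly_funs I" "i \<in> S" "j \<in> S"
  shows "(\<lambda>a. fpow S (\<lambda>i j. \<kappa> i j a) k i j) \<in> poly_funs I"
  using assms(2,3)
proof (induction k arbitrary: i j)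
  case (Suc k)
  then show ?case using assms(1)
    by (auto intro!: poly_funs_sum poly_funs.mult)
qed (auto intro: poly_funs.const)

text \<open>A resultant: \<open>R a\<close> is the determinant of \<open>\<phi>\<close> with the matrix \<open>\<kappa> a\<close> substituted for \<open>t\<close>.\<close>

lemma eliminate_parameter:
  assumes S: "finite S" and \<phi>: "\<phi> \<in> param_polys I"
    and \<kappa>: "\<forall>i\<in>S. \<forall>j\<in>S. \<kappa> i j \<in> poly_funs I"
  shows "\<exists>R\<in>poly_funs I.
    (\<forall>a t w. \<phi> (a, t) = 0 \<longrightarrow> (\<exists>i\<in>S. w i \<noteq> 0) \<longrightarrow>
      (\<forall>i\<in>S. (\<Sum>j\<in>S. \<kappa> i j a * w j) = t * w i) \<longrightarrow> R a = 0) \<and>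
    (\<forall>a c. c \<noteq> 0 \<longrightarrow> (\<forall>t. \<phi> (a, t) = c) \<longrightarrow> R a \<noteq> 0)"
proof -
  obtain g D where g: "\<And>a. degree (g a) \<le> D" "\<And>k. (\<lambda>a. coeff (g a) k) \<in> poly_funs I"
    "\<And>a t. \<phi> (a, t) = poly (g a) t" using param_polysD[OF \<phi>] by blast
  \<comment> \<open>An eigenvector of the matrix \<open>\<kappa>\<close> at \<open>a\<close> for
    \<open>t\<close> is an eigenvector of \<open>M a\<close> for \<open>poly (g a) t\<close>, which
    equals \<open>\<phi> (a, t)\<close>. If \<open>g a\<close> is a constant, \<open>M a\<close> is
    a scalar matrix.\<close>
  define M where "M a i j = (\<Sum>k\<le>D. coeff (g a) k * fpow S (\<lambda>i j. \<kappa> i j a) k i j)" for a i j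
  show ?thesis
  proof (intro bexI[of _ "\<lambda>a. fdet S (M a)"] conjI allI impI)
    show "(\<lambda>a. fdet S (M a)) \<in> poly_funs I"
      unfolding M_def
      by (intro fdet_in_fun_algebra[OF fun_algebra_poly_funs S] poly_funs_sum poly_funs.mult g(2)
          poly_funs_fpow \<kappa>[rule_format])
  next
    fix a t w
    assume \<phi>0: "\<phi> (a, t) = 0" and w: "\<exists>i\<in>S. w i \<noteq> 0"
      "\<forall>i\<in>S. (\<Sum>j\<in>S. \<kappa> i j a * w j) = t * w i"
    have poly: "poly (g a) t = (\<Sum>k\<le>D. coeff (g a) k * t ^ k)"
      unfolding poly_altdef using g(1)[of a]
      by (intro sum.mono_neutral_left) (auto simp: coeff_eq_0)
    have "(\<Sum>j\<in>S. M a i j * w j) = 0" if i: "i \<in> S" for i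
    proof -
      have "(\<Sum>j\<in>S. M a i j * w j) =
          (\<Sum>j\<in>S. \<Sum>k\<le>D. coeff (g a) k * (fpow S (\<lambda>i j. \<kappa> i j a) k i j * w j))"
        by (simp add: M_def sum_distrib_right mult.assoc)
      also have "\<dots> = (\<Sum>k\<le>D. \<Sum>j\<in>S. coeff (g a) k * (fpow S (\<lambda>i j. \<kappa> i j a) k i j * w j))"
        by (rule sum.swap)
      also have "\<dots> = (\<Sum>k\<le>D. coeff (g a) k * (t ^ k * w i))"
        using fpow_eigenvector[of S "\<lambda>i j. \<kappa> i j a" w t, OF S w(2)[rule_format] i]
        by (simp add: sum_distrib_left[symmetric])
      also have "\<dots> = poly (g a) t * w i"
        by (simp add: poly sum_distrib_right mult.assoc)
      finally show ?thesis using \<phi>0 g(3) by simp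
    qed
    then show "fdet S (M a) = 0" using w(1) by (auto simp: fdet_eq_0_iff[OF S])
  next
    fix a c assume c: "c \<noteq> 0" "\<forall>t. \<phi> (a, t) = c"
    have "g a = [:c:]" using c(2) g(3)[of a] by (simp add: poly_eq_poly_eq_iff[symmetric] fun_eq_iff)
    moreover have "(\<Sum>k\<le>D. coeff [:c:] k * f k) = c * f 0" for f
    proof -
      have "(\<Sum>k\<le>D. coeff [:c:] k * f k) = (\<Sum>k\<in>{0}. coeff [:c:] k * f k)"
        by (rule sum.mono_neutral_right) (auto simp: coeff_pCons split: nat.split)
      then show ?thesis by simp
    qed
    ultimately have "M a = (\<lambda>i j. if i = j then c else 0)"
      by (auto simp: M_def fun_eq_iff)
    then show "fdet S (M a) \<noteq> 0" using fdet_scalar_nonzero[OF S c(1)] by simp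
  qed
qed

section \<open>Monomials modulo the eigenvector equations\<close>

abbreviation mono_at :: "(nat \<Rightarrow> complex) \<Rightarrow> nat list \<Rightarrow> complex" where
  "mono_at x js \<equiv> (\<Prod>j\<leftarrow>js. x j)"

lemma finite_multi_indices: "finite (multi_indices n N)"
proof -
  have "multi_indices n N = {xs. set xs \<subseteq> {..<n} \<and> length xs = N}"
    by (auto simp: multi_indices_def)
  then show ?thesis using finite_lists_length_eq[of "{..<n}" N] by simp
qed

lemma multi_indices_append:
  "js \<in> multi_indices n N \<Longrightarrow> ks \<in> multi_indices n M \<Longrightarrow> js @ ks \<in> multi_indices n (N + M)"
  by (auto simp: multi_indices_def)

lemma mono_at_mset: "mset js = mset ks \<Longrightarrow> mono_at x js = mono_at x ks"
  by (metis mset_map prod_mset_prod_list)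

text \<open>Here \<open>w\<close> is the parameter and \<open>K\<close> the class of admissible
  coefficients. Monomials are index lists, so one monomial occurs once for each order of its
  factors; this is harmless, as only the existence of a representation matters.\<close>

definition lin_combs ::
  "nat \<Rightarrow> ('w \<Rightarrow> complex) set \<Rightarrow> nat \<Rightarrow> ('w \<Rightarrow> (nat \<Rightarrow> complex) \<Rightarrow> complex) set" where
  "lin_combs n K N = {g. \<exists>\<kappa>. (\<forall>\<nu>\<in>multi_indices n N. \<kappa> \<nu> \<in> K) \<and>
     g = (\<lambda>w x. \<Sum>\<nu>\<in>multi_indices n N. \<kappa> \<nu> w * mono_at x \<nu>)}"

text \<open>Only constant scalars are required. In both applications \<open>K\<close> consists of
  functions vanishing at a special hypermatrix, and in one of them it is not stable under
  multiplication by the pencil parameter.\<close>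

definition coeff_module :: "('w \<Rightarrow> complex) set \<Rightarrow> bool" where
  "coeff_module K \<longleftrightarrow> (\<lambda>_. 0) \<in> K \<and> (\<forall>f\<in>K. \<forall>g\<in>K. (\<lambda>w. f w + g w) \<in> K) \<and>
     (\<forall>f\<in>K. \<forall>c. (\<lambda>w. c * f w) \<in> K)"

lemma coeff_module_UNIV: "coeff_module UNIV"
  by (simp add: coeff_module_def)

lemma lin_combs_zero: "coeff_module K \<Longrightarrow> (\<lambda>w x. 0) \<in> lin_combs n K N"
  unfolding lin_combs_def coeff_module_def by (auto intro!: exI[of _ "\<lambda>_ _. 0"])

lemma lin_combs_add:
  assumes K: "coeff_module K" and f: "f \<in> lin_combs n K N" and g: "g \<in> lin_combs n K N"
  shows "(\<lambda>w x. f w x + g w x) \<in> lin_combs n K N"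
proof -
  obtain \<kappa> \<kappa>' where "\<forall>\<nu>\<in>multi_indices n N. \<kappa> \<nu> \<in> K" "\<forall>\<nu>\<in>multi_indices n N. \<kappa>' \<nu> \<in> K"
    and "f = (\<lambda>w x. \<Sum>\<nu>\<in>multi_indices n N. \<kappa> \<nu> w * mono_at x \<nu>)"
      "g = (\<lambda>w x. \<Sum>\<nu>\<in>multi_indices n N. \<kappa>' \<nu> w * mono_at x \<nu>)"
    using f g unfolding lin_combs_def by blast
  then show ?thesis using K unfolding lin_combs_def coeff_module_def
    by (auto intro!: exI[of _ "\<lambda>\<nu> w. \<kappa> \<nu> w + \<kappa>' \<nu> w"] simp: distrib_right sum.distrib)
qed

lemma lin_combs_scale:
  assumes "\<And>f. f \<in> K \<Longrightarrow> (\<lambda>w. h w * f w) \<in> K" and g: "g \<in> lin_combs n K N"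
  shows "(\<lambda>w x. h w * g w x) \<in> lin_combs n K N"
proof -
  obtain \<kappa> where "\<forall>\<nu>\<in>multi_indices n N. \<kappa> \<nu> \<in> K"
    and "g = (\<lambda>w x. \<Sum>\<nu>\<in>multi_indices n N. \<kappa> \<nu> w * mono_at x \<nu>)"
    using g unfolding lin_combs_def by blast
  then show ?thesis using assms(1) unfolding lin_combs_def
    by (auto intro!: exI[of _ "\<lambda>\<nu> w. h w * \<kappa> \<nu> w"] simp: sum_distrib_left mult.assoc)
qed

lemma lin_combs_single:
  assumes "coeff_module K" "f \<in> K" "\<nu> \<in> multi_indices n N"
  shows "(\<lambda>w x. f w * mono_at x \<nu>) \<in> lin_combs n K N"
proof -
  define \<kappa> where "\<kappa> \<mu> = (if \<mu> = \<nu> then f else (\<lambda>_. 0))" for \<mu>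
  have "(\<Sum>\<mu>\<in>multi_indices n N. \<kappa> \<mu> w * mono_at x \<mu>) = f w * mono_at x \<nu>" for w x
  proof -
    have "(\<Sum>\<mu>\<in>multi_indices n N. \<kappa> \<mu> w * mono_at x \<mu>) =
        (\<Sum>\<mu>\<in>{\<nu>}. \<kappa> \<mu> w * mono_at x \<mu>)"
      using assms(3) finite_multi_indices
      by (intro sum.mono_neutral_right) (auto simp: \<kappa>_def)
    then show ?thesis by (simp add: \<kappa>_def)
  qed
  moreover have "\<kappa> \<mu> \<in> K" for \<mu> using assms(1,2) by (simp add: \<kappa>_def coeff_module_def)
  ultimately show ?thesis unfolding lin_combs_def by (auto intro!: exI[of _ \<kappa>])
qed

lemma lin_combs_sum:
  assumes "coeff_module K" "\<And>i. i \<in> X \<Longrightarrow> f i \<in> lin_combs n K N"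
  shows "(\<lambda>w x. \<Sum>i\<in>X. f i w x) \<in> lin_combs n K N"
  using assms(2)
  by (induction X rule: infinite_finite_induct)
    (auto intro: lin_combs_zero lin_combs_add assms(1))

lemma lin_combs_mult_mono:
  assumes K: "coeff_module K" and g: "g \<in> lin_combs n K N" and \<rho>: "\<rho> \<in> multi_indices n M"
  shows "(\<lambda>w x. g w x * mono_at x \<rho>) \<in> lin_combs n K (N + M)"
proof -
  obtain \<kappa> where \<kappa>: "\<forall>\<nu>\<in>multi_indices n N. \<kappa> \<nu> \<in> K"
    and g: "g = (\<lambda>w x. \<Sum>\<nu>\<in>multi_indices n N. \<kappa> \<nu> w * mono_at x \<nu>)"
    using g unfolding lin_combs_def by blast
  have "(\<lambda>w x. \<Sum>\<nu>\<in>multi_indices n N. \<kappa> \<nu> w * mono_at x (\<nu> @ \<rho>)) \<in> lin_combs n K (N + M)"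
    using \<kappa> by (intro lin_combs_sum lin_combs_single K multi_indices_append \<rho>) auto
  then show ?thesis by (simp add: g sum_distrib_right mult.assoc)
qed

text \<open>A congruence modulo \<open>x 0\<close>, valid on the pairs in \<open>E\<close>:
  \<open>s * u\<close> agrees with a form whose coefficients lie in \<open>K\<close>. The cofactor
  \<open>h\<close> has arbitrary coefficients because only \<open>g\<close> enters the
  determinant.\<close>

definition reducible :: "nat \<Rightarrow> ('w \<Rightarrow> complex) set \<Rightarrow> ('w \<Rightarrow> complex) \<Rightarrow> ('w \<times> (nat \<Rightarrow> complex)) set \<Rightarrow>
    nat \<Rightarrow> ('w \<Rightarrow> (nat \<Rightarrow> complex) \<Rightarrow> complex) \<Rightarrow> bool" where
  "reducible n K s E N u \<longleftrightarrow> (\<exists>g\<in>lin_combs n K (Suc N). \<exists>h\<in>lin_combs n UNIV N.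
     \<forall>(w, x)\<in>E. s w * u w x = g w x + x 0 * h w x)"

lemma reducibleI:
  assumes "g \<in> lin_combs n K (Suc N)" "h \<in> lin_combs n UNIV N"
    and "\<And>w x. (w, x) \<in> E \<Longrightarrow> s w * u w x = g w x + x 0 * h w x"
  shows "reducible n K s E N u"
  unfolding reducible_def using assms by blast

lemma reducibleD:
  "reducible n K s E N u \<Longrightarrow> \<exists>g h. g \<in> lin_combs n K (Suc N) \<and> h \<in> lin_combs n UNIV N \<and>
     (\<forall>w x. (w, x) \<in> E \<longrightarrow> s w * u w x = g w x + x 0 * h w x)"
  unfolding reducible_def by blast

lemma reducible_zero: "coeff_module K \<Longrightarrow> reducible n K s E N (\<lambda>w x. 0)"
  by (rule reducibleI[OF lin_combs_zero lin_combs_zero[OF coeff_module_UNIV]]) auto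

lemma reducible_add:
  assumes K: "coeff_module K" and u: "reducible n K s E N u" and v: "reducible n K s E N v"
  shows "reducible n K s E N (\<lambda>w x. u w x + v w x)"
proof -
  obtain g h where g: "g \<in> lin_combs n K (Suc N)" "h \<in> lin_combs n UNIV N"
    "\<And>w x. (w, x) \<in> E \<Longrightarrow> s w * u w x = g w x + x 0 * h w x" using reducibleD[OF u] by blast
  obtain g' h' where g': "g' \<in> lin_combs n K (Suc N)" "h' \<in> lin_combs n UNIV N"
    "\<And>w x. (w, x) \<in> E \<Longrightarrow> s w * v w x = g' w x + x 0 * h' w x" using reducibleD[OF v] by blast
  show ?thesis
    by (rule reducibleI[OF lin_combs_add[OF K g(1) g'(1)]
          lin_combs_add[OF coeff_module_UNIV g(2) g'(2)]])
      (simp add: distrib_left g(3) g'(3))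
qed

lemma reducible_scale:
  assumes c: "\<And>f. f \<in> K \<Longrightarrow> (\<lambda>w. c w * f w) \<in> K" and u: "reducible n K s E N u"
  shows "reducible n K s E N (\<lambda>w x. c w * u w x)"
proof -
  obtain g h where g: "g \<in> lin_combs n K (Suc N)" "h \<in> lin_combs n UNIV N"
    "\<And>w x. (w, x) \<in> E \<Longrightarrow> s w * u w x = g w x + x 0 * h w x" using reducibleD[OF u] by blast
  have "s w * (c w * u w x) = c w * g w x + x 0 * (c w * h w x)" if "(w, x) \<in> E" for w x
    using g(3)[OF that] by (metis distrib_left mult.left_commute)
  then show ?thesis
    by (intro reducibleI[OF lin_combs_scale[of K c, OF c g(1)] lin_combs_scale[of UNIV c, OF _ g(2)]]) auto
qed

text \<open>On eigenvectors of the pencil, \<open>x\<^bsub>k+1\<^esub>\<^bsup>d+1\<^esup>\<close> may be replaced by monomials with more weight on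
  small indices. Rewriting stops at monomials containing \<open>x\<^sub>0\<close>, because a monomial in
  \<open>x\<^sub>1, \<dots>, x\<^bsub>n-1\<^esub>\<close> of degree larger than \<open>(n - 1) * d\<close> contains some \<open>x\<^bsub>k+1\<^esub>\<^bsup>d+1\<^esup>\<close>.\<close>

lemma reducible_monomials:
  assumes d: "d \<ge> 1" and K: "coeff_module K"
    and \<tau>: "\<And>f. f \<in> K \<Longrightarrow> (\<lambda>w. \<tau> w * f w) \<in> K"
    and rel: "\<And>k. Suc k < n \<Longrightarrow> \<exists>g\<in>lin_combs n K (Suc d). \<forall>(w, x)\<in>E.
      s w * x (Suc k) ^ Suc d =
      s w * ((if Suc (Suc k) < n then x k * x (Suc (Suc k)) ^ d else 0) + \<tau> w * x k ^ Suc d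
        - (if k = 0 then 0 else \<tau> w * (x (k - 1) ^ d * x (Suc k)))) + g w x"
    and N: "N \<ge> n * d" and "\<mu> \<in> multi_indices n (Suc N)"
  shows "reducible n K s E N (\<lambda>w x. mono_at x \<mu>)"
proof -
  \<comment> \<open>The base is chosen so that \<open>wt k\<close> equals
    \<open>Suc d * wt (Suc k)\<close>. Hence trading \<open>Suc d\<close> factors of index
    \<open>Suc k\<close> for one factor of index \<open>k\<close> together with any further factors
    raises the weight.\<close>
  define wt where "wt i = Suc d ^ (n - i)" for i
  define W where "W \<mu> = sum_list (map wt \<mu>)" for \<mu>
  have W_mset: "W \<mu> = W \<nu>" if "mset \<mu> = mset \<nu>" for \<mu> \<nu>
    unfolding W_def using that by (metis mset_map sum_mset_sum_list)
  have W_le: "W \<mu> \<le> Suc N * Suc d ^ n" if "\<mu> \<in> multi_indices n (Suc N)" for \<mu>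
  proof -
    have "W \<mu> \<le> sum_list (map (\<lambda>_. Suc d ^ n) \<mu>)"
      unfolding W_def by (rule sum_list_mono) (simp add: wt_def power_increasing)
    then show ?thesis using that by (simp add: sum_list_triv multi_indices_def)
  qed
  have wt_pos: "wt i > 0" for i by (simp add: wt_def)
  have wt_Suc: "wt k = Suc d * wt (Suc k)" if "Suc k < n" for k
    using that by (simp add: wt_def Suc_diff_Suc[symmetric])
  have wt_less: "wt (Suc k) < wt k" if "Suc k < n" for k
    using wt_Suc[OF that] wt_pos[of "Suc k"] d by simp
  show ?thesis using assms(6)
  \<comment> \<open>Each rewriting raises \<open>W\<close>, which \<open>W_le\<close> bounds from
    above; the induction is on the remaining gap.\<close>
  proof (induction "Suc N * Suc d ^ n - W \<mu>" arbitrary: \<mu> rule: less_induct)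
    case less
    have IH: "reducible n K s E N (\<lambda>w x. mono_at x \<nu>)"
      if "\<nu> \<in> multi_indices n (Suc N)" "W \<mu> < W \<nu>" for \<nu>
      using that W_le[OF that(1)] by (intro less.hyps) auto
    show ?case
    proof (cases "0 \<in> set \<mu>")
      case True
      then obtain ys zs where \<mu>: "\<mu> = ys @ 0 # zs" by (meson split_list)
      have "ys @ zs \<in> multi_indices n N"
        using less.prems by (auto simp: \<mu> multi_indices_def)
      then have "(\<lambda>w x. s w * mono_at x (ys @ zs)) \<in> lin_combs n UNIV N"
        by (intro lin_combs_single coeff_module_UNIV) auto
      then show ?thesis
        by (rule reducibleI[OF lin_combs_zero[OF K]]) (simp add: \<mu> mult_ac)
    next
      case False
      have set: "set \<mu> \<subseteq> {1..<n}" and len: "length \<mu> = Suc N"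
        using less.prems False by (auto simp: multi_indices_def Suc_le_eq intro!: gr0I)
      have "\<exists>i\<in>{1..<n}. count_list \<mu> i \<ge> Suc d"
      proof (rule ccontr)
        assume "\<not> ?thesis"
        then have "(\<Sum>i\<in>{1..<n}. count_list \<mu> i) \<le> (\<Sum>i\<in>{1..<n}. d)"
          by (intro sum_mono) (auto simp: not_le less_Suc_eq_le)
        also have "\<dots> \<le> n * d" by simp
        finally show False using sum_count_set[OF set] len N by simp
      qed
      then obtain k where k: "Suc k < n" "count_list \<mu> (Suc k) \<ge> Suc d"
        by (metis Suc_le_D atLeastLessThan_iff One_nat_def)
      have sub: "replicate_mset (Suc d) (Suc k) \<subseteq># mset \<mu>"
        using k(2) by (simp only: count_le_replicate_mset_subset_eq[symmetric] count_mset)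
      obtain \<rho> where \<rho>': "mset \<rho> = mset \<mu> - replicate_mset (Suc d) (Suc k)"
        using ex_mset by blast
      have \<rho>: "mset \<mu> = mset (replicate (Suc d) (Suc k) @ \<rho>)"
        by (simp only: mset_append mset_replicate \<rho>' subset_mset.add_diff_inverse[OF sub])
      have len\<rho>: "Suc N = Suc d + length \<rho>"
        using arg_cong[OF \<rho>, of size] len by simp
      have "set \<mu> = set (replicate (Suc d) (Suc k) @ \<rho>)" using \<rho> mset_eq_setD by blast
      then have \<rho>mi: "\<rho> \<in> multi_indices n (length \<rho>)"
        using set by (auto simp: multi_indices_def)
      have W\<mu>: "W \<mu> = Suc d * wt (Suc k) + W \<rho>"
        using W_mset[OF \<rho>] by (simp add: W_def sum_list_replicate)
      define a b c where "a = k # replicate d (Suc (Suc k)) @ \<rho>"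
        and "b = replicate (Suc d) k @ \<rho>" and "c = replicate d (k - 1) @ Suc k # \<rho>"
      have ra: "reducible n K s E N (\<lambda>w x. mono_at x a)" if "Suc (Suc k) < n"
      proof (rule IH)
        show "a \<in> multi_indices n (Suc N)"
          using \<rho>mi that k(1) len\<rho> by (auto simp: a_def multi_indices_def)
        show "W \<mu> < W a"
          using W\<mu> wt_Suc[OF k(1)] wt_pos[of "Suc (Suc k)"] d
          by (simp add: W_def a_def sum_list_replicate)
      qed
      have rb: "reducible n K s E N (\<lambda>w x. mono_at x b)"
      proof (rule IH)
        show "b \<in> multi_indices n (Suc N)"
          using \<rho>mi k(1) len\<rho> by (auto simp: b_def multi_indices_def)
        have "Suc d * wt (Suc k) < Suc d * wt k"
          using wt_less[OF k(1)] by (intro mult_strict_left_mono) auto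
        then show "W \<mu> < W b"
          unfolding W\<mu> by (simp add: W_def b_def sum_list_replicate)
      qed
      have rc: "reducible n K s E N (\<lambda>w x. mono_at x c)" if "k \<noteq> 0"
      proof (rule IH)
        show "c \<in> multi_indices n (Suc N)"
          using \<rho>mi k(1) len\<rho> by (auto simp: c_def multi_indices_def)
        have "wt (Suc k) < wt (k - 1)"
          using wt_less[OF k(1)] wt_less[of "k - 1"] k(1) that by simp
        then have "d * wt (Suc k) < d * wt (k - 1)"
          using d by (intro mult_strict_left_mono) auto
        then show "W \<mu> < W c"
          unfolding W\<mu> by (simp add: W_def c_def sum_list_replicate)
      qed
      define u where "u w x = (if Suc (Suc k) < n then mono_at x a else 0) + \<tau> w * mono_at x b
          + (-1) * (if k = 0 then 0 else \<tau> w * mono_at x c)" for w x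
      have "reducible n K s E N u"
        unfolding u_def
      proof (intro reducible_add K)
        show "reducible n K s E N (\<lambda>w x. if Suc (Suc k) < n then mono_at x a else 0)"
          using ra reducible_zero[OF K] by (cases "Suc (Suc k) < n") simp_all
        show "reducible n K s E N (\<lambda>w x. \<tau> w * mono_at x b)"
          by (rule reducible_scale[OF \<tau> rb])
        have "reducible n K s E N (\<lambda>w x. if k = 0 then 0 else \<tau> w * mono_at x c)"
          using reducible_scale[OF \<tau> rc] reducible_zero[OF K] by (cases "k = 0") simp_all
        then show "reducible n K s E N (\<lambda>w x. (-1) * (if k = 0 then 0 else \<tau> w * mono_at x c))"
        proof (rule reducible_scale[rotated])
          fix f assume "f \<in> K"
          then show "(\<lambda>w. (-1) * f w) \<in> K" using K unfolding coeff_module_def by blast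
        qed
      qed
      then obtain g h where g: "g \<in> lin_combs n K (Suc N)" "h \<in> lin_combs n UNIV N"
        "\<And>w x. (w, x) \<in> E \<Longrightarrow> s w * u w x = g w x + x 0 * h w x" using reducibleD by blast
      obtain g' where g': "g' \<in> lin_combs n K (Suc d)"
        "\<And>w x. (w, x) \<in> E \<Longrightarrow> s w * x (Suc k) ^ Suc d =
          s w * ((if Suc (Suc k) < n then x k * x (Suc (Suc k)) ^ d else 0) + \<tau> w * x k ^ Suc d
          - (if k = 0 then 0 else \<tau> w * (x (k - 1) ^ d * x (Suc k)))) + g' w x"
        using rel[OF k(1)] by blast
      have "(\<lambda>w x. g' w x * mono_at x \<rho>) \<in> lin_combs n K (Suc N)"
        using lin_combs_mult_mono[OF K g'(1) \<rho>mi] len\<rho> by simp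
      from lin_combs_add[OF K g(1) this] g(2) show ?thesis
      proof (rule reducibleI)
        fix w x assume E: "(w, x) \<in> E"
        \<comment> \<open>The relation is linear in \<open>s\<close>, and its right side again
          carries the factor \<open>s\<close>. So \<open>s\<close> never accumulates, and the
          coefficients in \<open>K\<close> stay free of it even when \<open>s\<close> is the pencil
          parameter.\<close>
        have "s w * mono_at x \<mu> = (s w * x (Suc k) ^ Suc d) * mono_at x \<rho>"
          unfolding mono_at_mset[OF \<rho>] by (simp add: prod_list_replicate mult_ac)
        also have "\<dots> = s w * u w x + g' w x * mono_at x \<rho>"
          unfolding g'(2)[OF E] u_def a_def b_def c_def
          by (simp add: prod_list_replicate algebra_simps)
        finally show "s w * mono_at x \<mu> = (g w x + g' w x * mono_at x \<rho>) + x 0 * h w x"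
          using g(3)[OF E] by simp
      qed
    qed
  qed
qed

section \<open>Eigenvectors of hypermatrices\<close>

lemma mono_at_scale: "mono_at (\<lambda>i. t * x i) js = t ^ length js * mono_at x js"
  by (induction js) (simp_all add: mult_ac)

lemma mono_at_cong: "(\<And>i. i \<in> set js \<Longrightarrow> x i = y i) \<Longrightarrow> mono_at x js = mono_at y js"
  by (metis map_cong)

lemma hm_apply_scale: "hm_apply n m A (\<lambda>i. t * x i) i = t ^ (m - 1) * hm_apply n m A x i"
  by (simp add: hm_apply_def mono_at_scale multi_indices_def sum_distrib_left mult_ac)

lemma hm_apply_cong: "(\<And>i. i < n \<Longrightarrow> x i = y i) \<Longrightarrow> hm_apply n m A x = hm_apply n m A y"
  unfolding hm_apply_def
  by (intro ext if_cong refl sum.cong arg_cong2[where f = "(*)"] mono_at_cong)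
    (auto simp: multi_indices_def)

lemma hm_apply_add:
  "hm_apply n m (\<lambda>js. A js + t * B js) x i = hm_apply n m A x i + t * hm_apply n m B x i"
  by (simp add: hm_apply_def sum.distrib sum_distrib_left algebra_simps)

lemma hm_apply_scale_tensor: "hm_apply n m (\<lambda>js. c * A js) x i = c * hm_apply n m A x i"
  by (simp add: hm_apply_def sum_distrib_left mult_ac)

section \<open>Eigenpair classes as points of projective space\<close>

lemma eigenpairs_scale:
  assumes "m \<ge> 2" "(l, x) \<in> eigenpairs n m A" "t \<noteq> 0"
  shows "(t ^ (m - 2) * l, \<lambda>i. t * x i) \<in> eigenpairs n m A"
proof -
  have "m - 1 = Suc (m - 2)" using assms(1) by simp
  then have "hm_apply n m A (\<lambda>i. t * x i) i = t ^ (m - 2) * l * (t * x i)" for i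
    using assms(2) by (simp add: hm_apply_scale eigenpairs_def)
  then show ?thesis
    using assms(2) nonzero_vectors_scale[OF _ assms(3)] by (auto simp: eigenpairs_def)
qed

lemma eigenpairs_unique:
  assumes "(l, x) \<in> eigenpairs n m A" "(l', x) \<in> eigenpairs n m A"
  shows "l = l'"
proof -
  obtain i where "x i \<noteq> 0"
    using assms(1) by (auto simp: eigenpairs_def nonzero_vectors_def)
  moreover have "l * x i = l' * x i"
    using assms by (auto simp: eigenpairs_def dest: fun_cong)
  ultimately show ?thesis by simp
qed

text \<open>The eigenvalue is determined by the vector and changes by the factor
  \<open>t ^ (m - 2)\<close> under scaling, so an equivalence class is determined by the projective
  point of its vectors.\<close>

lemma eigenpair_class:
  assumes m: "m \<ge> 2" and lx: "(l, x) \<in> eigenpairs n m A"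
  shows "eigenpair_rel n m A `` {(l, x)} =
    {e \<in> eigenpairs n m A. snd e \<in> proportional {..<n} `` {x}}"
proof
  show "eigenpair_rel n m A `` {(l, x)} \<subseteq>
      {e \<in> eigenpairs n m A. snd e \<in> proportional {..<n} `` {x}}"
    by (auto simp: eigenpair_rel_def proportional_def eigenpairs_def)
  show "{e \<in> eigenpairs n m A. snd e \<in> proportional {..<n} `` {x}} \<subseteq>
      eigenpair_rel n m A `` {(l, x)}"
  proof
    fix e assume "e \<in> {e \<in> eigenpairs n m A. snd e \<in> proportional {..<n} `` {x}}"
    then obtain l' t where t: "t \<noteq> 0" "e = (l', \<lambda>i. t * x i)" "e \<in> eigenpairs n m A"
      by (cases e) (auto simp: proportional_def)
    then have "l' = t ^ (m - 2) * l"
      using eigenpairs_unique eigenpairs_scale[OF m lx t(1)] by blast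
    then show "e \<in> eigenpair_rel n m A `` {(l, x)}"
      using t lx unfolding eigenpair_rel_def by auto
  qed
qed

text \<open>A class can be recovered from its set of vectors, so forgetting eigenvalues is a
  bijection from classes to the lines of eigenvectors.\<close>

lemma infinitely_many_eigenpairs_iff:
  assumes m: "m \<ge> 2"
  shows "infinitely_many_eigenpairs n m A \<longleftrightarrow> infinite (lines {..<n} (snd ` eigenpairs n m A))"
proof -
  let ?E = "eigenpairs n m A" and ?r = "eigenpair_rel n m A" and ?p = "proportional {..<n}"
  have img: "snd ` (?r `` {(l, x)}) = ?p `` {x}" if lx: "(l, x) \<in> ?E" for l x
  proof
    show "snd ` (?r `` {(l, x)}) \<subseteq> ?p `` {x}"
      unfolding eigenpair_class[OF m lx] by auto
    show "?p `` {x} \<subseteq> snd ` (?r `` {(l, x)})"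
    proof
      fix y assume y: "y \<in> ?p `` {x}"
      then obtain t where "t \<noteq> 0" "y = (\<lambda>i. t * x i)" by (auto simp: proportional_def)
      then have "(t ^ (m - 2) * l, y) \<in> ?r `` {(l, x)}"
        using eigenpairs_scale[OF m lx] y unfolding eigenpair_class[OF m lx] by simp
      then show "y \<in> snd ` (?r `` {(l, x)})" by force
    qed
  qed
  have C_eq: "C = {e \<in> ?E. snd e \<in> snd ` C}" if C: "C \<in> ?E // ?r" for C
  proof -
    obtain e where "e \<in> ?E" "C = ?r `` {e}" using C by (rule quotientE)
    then obtain l x where lx: "(l, x) \<in> ?E" "C = ?r `` {(l, x)}" by (cases e) blast
    show ?thesis unfolding lx(2) img[OF lx(1)] by (rule eigenpair_class[OF m lx(1)])
  qed
  have "inj_on (\<lambda>C. snd ` C) (?E // ?r)"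
  proof (rule inj_onI)
    fix C D assume C: "C \<in> ?E // ?r" and D: "D \<in> ?E // ?r" and eq: "snd ` C = snd ` D"
    have "C = {e \<in> ?E. snd e \<in> snd ` C}" by (rule C_eq[OF C])
    also have "\<dots> = {e \<in> ?E. snd e \<in> snd ` D}" by (simp only: eq)
    also have "\<dots> = D" by (rule C_eq[OF D, symmetric])
    finally show "C = D" .
  qed
  moreover have "(\<lambda>C. snd ` C) ` (?E // ?r) = lines {..<n} (snd ` ?E)"
  proof -
    have "?E // ?r = (\<lambda>e. ?r `` {e}) ` ?E" by (auto simp: quotient_def)
    then have "(\<lambda>C. snd ` C) ` (?E // ?r) = (\<lambda>e. snd ` (?r `` {e})) ` ?E"
      by (simp only: image_image)
    also have "\<dots> = (\<lambda>e. ?p `` {snd e}) ` ?E"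
    proof (rule image_cong[OF refl])
      fix e assume "e \<in> ?E"
      then show "snd ` (?r `` {e}) = ?p `` {snd e}" using img by (cases e) simp
    qed
    finally show ?thesis by (simp only: lines_def image_image)
  qed
  ultimately show ?thesis
    unfolding infinitely_many_eigenpairs_def by (metis finite_image_iff)
qed

lemma infinitely_many_eigenpairs_scale:
  assumes "m \<ge> 2" "c \<noteq> 0" "infinitely_many_eigenpairs n m A"
  shows "infinitely_many_eigenpairs n m (\<lambda>js. c * A js)"
proof -
  have "snd ` eigenpairs n m A \<subseteq> snd ` eigenpairs n m (\<lambda>js. c * A js)"
  proof
    fix x assume "x \<in> snd ` eigenpairs n m A"
    then obtain l where "(l, x) \<in> eigenpairs n m A" by auto
    then have "(c * l, x) \<in> eigenpairs n m (\<lambda>js. c * A js)"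
      by (auto simp: eigenpairs_def hm_apply_scale_tensor fun_eq_iff)
    then show "x \<in> snd ` eigenpairs n m (\<lambda>js. c * A js)" by force
  qed
  then have "lines {..<n} (snd ` eigenpairs n m A) \<subseteq>
      lines {..<n} (snd ` eigenpairs n m (\<lambda>js. c * A js))"
    unfolding lines_def by (rule image_mono)
  then show ?thesis
    using assms(3) infinite_super unfolding infinitely_many_eigenpairs_iff[OF assms(1)] by blast
qed

text \<open>Normalising the coordinate \<open>r\<close> to 1 picks a representative of each line
  whose coordinates all lie in the finite set \<open>B\<close>.\<close>

lemma finite_lines:
  fixes V :: "(nat \<Rightarrow> complex) set"
  assumes V: "V \<subseteq> nonzero_vectors {..<n}"
    and B: "finite B" "\<And>x i. x \<in> V \<Longrightarrow> i < n \<Longrightarrow> x i / x r \<in> B"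
    and r: "\<And>x. x \<in> V \<Longrightarrow> x r \<noteq> 0"
  shows "finite (lines {..<n} V)"
proof -
  define Y where "Y = {y :: nat \<Rightarrow> complex. \<forall>i. (i \<in> {..<n} \<longrightarrow> y i \<in> B) \<and> (i \<notin> {..<n} \<longrightarrow> y i = 0)}"
  have "finite Y" unfolding Y_def by (intro finite_set_of_finite_funs B(1)) auto
  moreover have "lines {..<n} V \<subseteq> lines {..<n} Y"
  proof
    fix P assume "P \<in> lines {..<n} V"
    then obtain x where x: "x \<in> V" "P = proportional {..<n} `` {x}" by (auto simp: lines_def)
    define y where "y = (\<lambda>i. inverse (x r) * x i)"
    have "(x, y) \<in> proportional {..<n}"
      using x(1) V r[OF x(1)] nonzero_vectors_scale[of x "{..<n}" "inverse (x r)"]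
      by (auto simp: proportional_def y_def intro!: exI[of _ "inverse (x r)"])
    then have "P = proportional {..<n} `` {y}"
      unfolding x(2) by (rule equiv_class_eq[OF equiv_proportional])
    moreover have "y \<in> Y"
      using B(2)[OF x(1)] x(1) V
      by (auto simp: Y_def y_def nonzero_vectors_def coord_space_def field_simps)
    ultimately show "P \<in> lines {..<n} Y" by (auto simp: lines_def)
  qed
  ultimately show ?thesis unfolding lines_def by (meson finite_imageI finite_subset)
qed

text \<open>If the determinant did not vanish, every monomial of degree \<open>N + 1\<close> would be \<open>x\<^sub>0\<close> times a
  combination of monomials of degree \<open>N\<close> on all eigenvectors. Hence each ratio \<open>x\<^sub>j / x\<^sub>0\<close> would be an
  eigenvalue of a fixed matrix.\<close>

lemma infinite_eigenvectors_imp_fdet_eq_0: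
  assumes m: "m \<ge> 2" and n: "n \<ge> 1" and \<sigma>: "bij_betw \<sigma> {..<n} {..<n}"
    and red: "\<And>\<mu> l x. \<mu> \<in> multi_indices n (Suc N) \<Longrightarrow> (l, x) \<in> eigenpairs n m A \<Longrightarrow>
      s * mono_at (\<lambda>i. x (\<sigma> i)) \<mu> =
      (\<Sum>\<nu>\<in>multi_indices n (Suc N). \<kappa> \<mu> \<nu> * mono_at (\<lambda>i. x (\<sigma> i)) \<nu>) +
      x (\<sigma> 0) * (\<Sum>\<nu>\<in>multi_indices n N. H \<mu> \<nu> * mono_at (\<lambda>i. x (\<sigma> i)) \<nu>)"
    and inf: "infinitely_many_eigenpairs n m A"
  shows "fdet (multi_indices n (Suc N)) (\<lambda>\<mu> \<nu>. (if \<mu> = \<nu> then s else 0) - \<kappa> \<mu> \<nu>) = 0"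
proof (rule ccontr)
  let ?S = "multi_indices n (Suc N)" and ?T = "multi_indices n N"
  let ?M = "\<lambda>\<mu> \<nu>. (if \<mu> = \<nu> then s else 0) - \<kappa> \<mu> \<nu>"
  have fin: "finite ?S" "finite ?T" by (rule finite_multi_indices)+
  assume "fdet ?S ?M \<noteq> 0"
  then obtain L where L: "\<And>\<mu> \<nu>. \<mu> \<in> ?S \<Longrightarrow> \<nu> \<in> ?S \<Longrightarrow>
      (\<Sum>\<rho>\<in>?S. L \<mu> \<rho> * ?M \<rho> \<nu>) = (if \<mu> = \<nu> then 1 else 0)"
    using fdet_inverse[OF fin(1)] by blast
  \<comment> \<open>The left inverse \<open>L\<close> solves the system: on every eigenvector a
    monomial of degree \<open>Suc N\<close> becomes \<open>x (\<sigma> 0)\<close> times a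
    combination of monomials of degree \<open>N\<close>, with coefficients \<open>H'\<close> that
    are the same for all eigenvectors.\<close>
  define H' where "H' \<mu> \<nu> = (\<Sum>\<rho>\<in>?S. L \<mu> \<rho> * H \<rho> \<nu>)" for \<mu> \<nu>
  define V where "V = snd ` eigenpairs n m A"
  have step: "mono_at (\<lambda>i. x (\<sigma> i)) \<mu> = x (\<sigma> 0) * (\<Sum>\<nu>\<in>?T. H' \<mu> \<nu> * mono_at (\<lambda>i. x (\<sigma> i)) \<nu>)"
    if x: "x \<in> V" and \<mu>: "\<mu> \<in> ?S" for x \<mu>
  proof -
    let ?v = "mono_at (\<lambda>i. x (\<sigma> i))"
    obtain l where lx: "(l, x) \<in> eigenpairs n m A" using x by (auto simp: V_def)
    have M: "(\<Sum>\<nu>\<in>?S. ?M \<rho> \<nu> * ?v \<nu>) = x (\<sigma> 0) * (\<Sum>\<nu>\<in>?T. H \<rho> \<nu> * ?v \<nu>)" if "\<rho> \<in> ?S" for \<rho>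
    proof -
      have "(\<Sum>\<nu>\<in>?S. ?M \<rho> \<nu> * ?v \<nu>) = s * ?v \<rho> - (\<Sum>\<nu>\<in>?S. \<kappa> \<rho> \<nu> * ?v \<nu>)"
        using that fin(1)
        by (simp add: left_diff_distrib sum_subtractf if_distrib[of "\<lambda>x. x * _"] sum.delta
            cong: if_cong)
      then show ?thesis using red[OF that lx] by simp
    qed
    have "?v \<mu> = (\<Sum>\<nu>\<in>?S. (if \<mu> = \<nu> then 1 else 0) * ?v \<nu>)"
      using \<mu> fin(1) by (simp add: if_distrib[of "\<lambda>x. x * _"] sum.delta cong: if_cong)
    also have "\<dots> = (\<Sum>\<nu>\<in>?S. (\<Sum>\<rho>\<in>?S. L \<mu> \<rho> * ?M \<rho> \<nu>) * ?v \<nu>)"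
      by (intro sum.cong refl) (simp only: L[OF \<mu>])
    also have "\<dots> = (\<Sum>\<nu>\<in>?S. \<Sum>\<rho>\<in>?S. L \<mu> \<rho> * (?M \<rho> \<nu> * ?v \<nu>))"
      by (simp only: sum_distrib_right mult.assoc)
    also have "\<dots> = (\<Sum>\<rho>\<in>?S. \<Sum>\<nu>\<in>?S. L \<mu> \<rho> * (?M \<rho> \<nu> * ?v \<nu>))"
      by (rule sum.swap)
    also have "\<dots> = (\<Sum>\<rho>\<in>?S. L \<mu> \<rho> * (x (\<sigma> 0) * (\<Sum>\<nu>\<in>?T. H \<rho> \<nu> * ?v \<nu>)))"
      by (intro sum.cong refl) (simp only: M sum_distrib_left[symmetric])
    also have "\<dots> = (\<Sum>\<rho>\<in>?S. \<Sum>\<nu>\<in>?T. x (\<sigma> 0) * (L \<mu> \<rho> * H \<rho> \<nu> * ?v \<nu>))"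
      by (simp only: sum_distrib_left mult_ac)
    also have "\<dots> = (\<Sum>\<nu>\<in>?T. \<Sum>\<rho>\<in>?S. x (\<sigma> 0) * (L \<mu> \<rho> * H \<rho> \<nu> * ?v \<nu>))"
      by (rule sum.swap)
    also have "\<dots> = x (\<sigma> 0) * (\<Sum>\<nu>\<in>?T. H' \<mu> \<nu> * ?v \<nu>)"
      by (simp only: H'_def sum_distrib_left sum_distrib_right)
    finally show ?thesis .
  qed
  have V: "V \<subseteq> nonzero_vectors {..<n}" by (auto simp: V_def eigenpairs_def)
  have nz: "x (\<sigma> 0) \<noteq> 0" if x: "x \<in> V" for x
  proof
    assume 0: "x (\<sigma> 0) = 0"
    have "x \<in> nonzero_vectors {..<n}" using V x by blast
    then have "\<exists>i. x i \<noteq> 0" "\<forall>i. x i \<noteq> 0 \<longrightarrow> i < n"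
      by (auto simp: nonzero_vectors_def coord_space_def)
    then obtain i where i: "x i \<noteq> 0" "i < n" by blast
    then obtain j where j: "j < n" "i = \<sigma> j" using \<sigma> by (auto simp: bij_betw_def)
    \<comment> \<open>By \<open>step\<close>, the pure power of the nonzero coordinate
      \<open>\<sigma> j\<close> would vanish.\<close>
    have "replicate (Suc N) j \<in> ?S" using j by (auto simp: multi_indices_def)
    from step[OF x this] 0 i(1) j show False by (simp add: prod_list_replicate)
  qed
  define Ev where "Ev j = {z. \<exists>w. (\<exists>\<mu>\<in>?T. w \<mu> \<noteq> 0) \<and>
    (\<forall>\<mu>\<in>?T. (\<Sum>\<nu>\<in>?T. H' (j # \<mu>) \<nu> * w \<nu>) = z * w \<mu>)}" for j
  have ratio: "x (\<sigma> j) / x (\<sigma> 0) \<in> Ev j" if x: "x \<in> V" and j: "j < n" for x j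
  proof -
    let ?v = "mono_at (\<lambda>i. x (\<sigma> i))"
    \<comment> \<open>The eigenvector is the vector of all monomials of degree \<open>N\<close>,
      nonzero at the power of the coordinate \<open>\<sigma> 0\<close>. Prefixing \<open>j\<close>
      multiplies each monomial by the coordinate \<open>\<sigma> j\<close>.\<close>
    have "replicate N 0 \<in> ?T" "?v (replicate N 0) \<noteq> 0"
      using n nz[OF x] by (auto simp: multi_indices_def prod_list_replicate)
    moreover have "(\<Sum>\<nu>\<in>?T. H' (j # \<mu>) \<nu> * ?v \<nu>) = x (\<sigma> j) / x (\<sigma> 0) * ?v \<mu>" if "\<mu> \<in> ?T" for \<mu>
    proof -
      have "j # \<mu> \<in> ?S" using j that by (auto simp: multi_indices_def)
      from step[OF x this] show ?thesis using nz[OF x] by (simp add: field_simps)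
    qed
    ultimately show ?thesis
      unfolding Ev_def mem_Collect_eq by (intro exI[of _ ?v] conjI ballI bexI[of _ "replicate N 0"])
  qed
  have "finite (\<Union>j<n. Ev j)"
    unfolding Ev_def by (intro finite_UN_I finite_eigenvalues fin) auto
  moreover have "x i / x (\<sigma> 0) \<in> (\<Union>j<n. Ev j)" if x: "x \<in> V" and i: "i < n" for x i
  proof -
    obtain j where "j < n" "i = \<sigma> j" using \<sigma> i by (auto simp: bij_betw_def)
    then show ?thesis using ratio[OF x] by blast
  qed
  ultimately have "finite (lines {..<n} V)"
    by (rule finite_lines[OF V _ _ nz])
  then show False
    using inf unfolding infinitely_many_eigenpairs_iff[OF m] V_def by simp
qed

text \<open>The coefficients \<open>\<kappa>\<close> are chosen before \<open>w\<close> and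
  \<open>A\<close>, so the determinant depends on \<open>w\<close> only through \<open>s\<close> and
  functions in \<open>K\<close>. The relabelling \<open>\<sigma>\<close> lets one reduction modulo
  \<open>x 0\<close> serve both the first and the last coordinate hyperplane.\<close>

lemma reducible_imp_fdet:
  assumes m: "m \<ge> 2" and n: "n \<ge> 1" and \<sigma>: "bij_betw \<sigma> {..<n} {..<n}"
    and red: "\<forall>\<mu>\<in>multi_indices n (Suc N). reducible n K s E N (\<lambda>w x. mono_at x \<mu>)"
  shows "\<exists>\<kappa>. (\<forall>\<mu>\<in>multi_indices n (Suc N). \<forall>\<nu>\<in>multi_indices n (Suc N). \<kappa> \<mu> \<nu> \<in> K) \<and>
    (\<forall>w A. (\<forall>l x. (l, x) \<in> eigenpairs n m A \<longrightarrow> (w, \<lambda>i. x (\<sigma> i)) \<in> E) \<longrightarrow>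
      infinitely_many_eigenpairs n m A \<longrightarrow>
      fdet (multi_indices n (Suc N)) (\<lambda>\<mu> \<nu>. (if \<mu> = \<nu> then s w else 0) - \<kappa> \<mu> \<nu> w) = 0)"
proof -
  let ?S = "multi_indices n (Suc N)" and ?T = "multi_indices n N"
  have "\<forall>\<mu>\<in>?S. \<exists>\<kappa> H. (\<forall>\<nu>\<in>?S. \<kappa> \<nu> \<in> K) \<and> (\<forall>w x. (w, x) \<in> E \<longrightarrow> s w * mono_at x \<mu> =
      (\<Sum>\<nu>\<in>?S. \<kappa> \<nu> w * mono_at x \<nu>) + x 0 * (\<Sum>\<nu>\<in>?T. H \<nu> w * mono_at x \<nu>))"
  proof
    fix \<mu> assume "\<mu> \<in> ?S"
    from reducibleD[OF red[rule_format, OF this]] obtain g h where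
      g: "g \<in> lin_combs n K (Suc N)" and h: "h \<in> lin_combs n UNIV N"
      and eq: "\<And>w x. (w, x) \<in> E \<Longrightarrow> s w * mono_at x \<mu> = g w x + x 0 * h w x" by blast
    from g obtain \<kappa> where \<kappa>: "\<forall>\<nu>\<in>?S. \<kappa> \<nu> \<in> K" "g = (\<lambda>w x. \<Sum>\<nu>\<in>?S. \<kappa> \<nu> w * mono_at x \<nu>)"
      unfolding lin_combs_def by blast
    from h obtain H where H: "h = (\<lambda>w x. \<Sum>\<nu>\<in>?T. H \<nu> w * mono_at x \<nu>)"
      unfolding lin_combs_def by blast
    show "\<exists>\<kappa> H. (\<forall>\<nu>\<in>?S. \<kappa> \<nu> \<in> K) \<and> (\<forall>w x. (w, x) \<in> E \<longrightarrow> s w * mono_at x \<mu> =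
      (\<Sum>\<nu>\<in>?S. \<kappa> \<nu> w * mono_at x \<nu>) + x 0 * (\<Sum>\<nu>\<in>?T. H \<nu> w * mono_at x \<nu>))"
      using eq \<kappa>(1) by (intro exI[of _ \<kappa>] exI[of _ H]) (simp add: \<kappa>(2) H)
  qed
  then obtain \<kappa> where "\<forall>\<mu>\<in>?S. \<exists>H. (\<forall>\<nu>\<in>?S. \<kappa> \<mu> \<nu> \<in> K) \<and> (\<forall>w x. (w, x) \<in> E \<longrightarrow> s w * mono_at x \<mu> =
      (\<Sum>\<nu>\<in>?S. \<kappa> \<mu> \<nu> w * mono_at x \<nu>) + x 0 * (\<Sum>\<nu>\<in>?T. H \<nu> w * mono_at x \<nu>))"
    by (rule bchoice[THEN exE])
  then obtain H where all: "\<forall>\<mu>\<in>?S. (\<forall>\<nu>\<in>?S. \<kappa> \<mu> \<nu> \<in> K) \<and> (\<forall>w x. (w, x) \<in> E \<longrightarrow> s w * mono_at x \<mu> =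
      (\<Sum>\<nu>\<in>?S. \<kappa> \<mu> \<nu> w * mono_at x \<nu>) + x 0 * (\<Sum>\<nu>\<in>?T. H \<mu> \<nu> w * mono_at x \<nu>))"
    by (rule bchoice[THEN exE])
  have \<kappa>: "\<And>\<mu> \<nu>. \<mu> \<in> ?S \<Longrightarrow> \<nu> \<in> ?S \<Longrightarrow> \<kappa> \<mu> \<nu> \<in> K"
    and eq: "\<And>\<mu> w x. \<mu> \<in> ?S \<Longrightarrow> (w, x) \<in> E \<Longrightarrow> s w * mono_at x \<mu> =
      (\<Sum>\<nu>\<in>?S. \<kappa> \<mu> \<nu> w * mono_at x \<nu>) + x 0 * (\<Sum>\<nu>\<in>?T. H \<mu> \<nu> w * mono_at x \<nu>)"
    using all by blast+
  show ?thesis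
  proof (intro exI[of _ \<kappa>] conjI ballI allI impI)
    show "\<kappa> \<mu> \<nu> \<in> K" if "\<mu> \<in> ?S" "\<nu> \<in> ?S" for \<mu> \<nu> by (rule \<kappa>[OF that])
    fix w A
    assume E: "\<forall>l x. (l, x) \<in> eigenpairs n m A \<longrightarrow> (w, \<lambda>i. x (\<sigma> i)) \<in> E"
      and inf: "infinitely_many_eigenpairs n m A"
    show "fdet ?S (\<lambda>\<mu> \<nu>. (if \<mu> = \<nu> then s w else 0) - \<kappa> \<mu> \<nu> w) = 0"
    proof (rule infinite_eigenvectors_imp_fdet_eq_0[OF m n \<sigma> _ inf])
      fix \<mu> l x assume "\<mu> \<in> ?S" "(l, x) \<in> eigenpairs n m A"
      then show "s w * mono_at (\<lambda>i. x (\<sigma> i)) \<mu> =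
        (\<Sum>\<nu>\<in>?S. \<kappa> \<mu> \<nu> w * mono_at (\<lambda>i. x (\<sigma> i)) \<nu>) +
        x (\<sigma> 0) * (\<Sum>\<nu>\<in>?T. H \<mu> \<nu> w * mono_at (\<lambda>i. x (\<sigma> i)) \<nu>)"
        using eq E by blast
    qed
  qed
qed

text \<open>The coefficients of this form of degree \<open>m\<close> are entries of
  \<open>b w\<close>, so the error terms of the cross relations inherit membership in
  \<open>K\<close>.\<close>

lemma lin_combs_hm_apply:
  assumes K: "coeff_module K" and m: "m \<ge> 1"
    and b: "\<And>js. js \<in> multi_indices n m \<Longrightarrow> (\<lambda>w. b w js) \<in> K"
    and \<sigma>: "\<And>i. i < n \<Longrightarrow> \<sigma> i < n" and ij: "i < n" "j < n"
  shows "(\<lambda>w x. hm_apply n m (b w) (\<lambda>i. x (\<sigma> i)) i * x j) \<in> lin_combs n K m"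
proof -
  have *: "(\<lambda>w x. \<Sum>js\<in>multi_indices n (m - 1). b w (i # js) * mono_at x (j # map \<sigma> js))
      \<in> lin_combs n K m"
  proof (intro lin_combs_sum lin_combs_single K b)
    fix js assume "js \<in> multi_indices n (m - 1)"
    then show "i # js \<in> multi_indices n m" "j # map \<sigma> js \<in> multi_indices n m"
      using m ij \<sigma> by (auto simp: multi_indices_def)
  qed
  have "(\<lambda>w x. hm_apply n m (b w) (\<lambda>i. x (\<sigma> i)) i * x j) =
      (\<lambda>w x. \<Sum>js\<in>multi_indices n (m - 1). b w (i # js) * mono_at x (j # map \<sigma> js))"
    using ij(1) by (simp add: hm_apply_def sum_distrib_left mult_ac comp_def fun_eq_iff)
  then show ?thesis using * by simp
qed

section \<open>A pencil of hypermatrices with finitely many eigenpairs\<close>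

definition up_tensor :: "nat \<Rightarrow> nat \<Rightarrow> nat list \<Rightarrow> complex" where
  "up_tensor n m js = (if \<exists>i. Suc i < n \<and> js = i # replicate (m - 1) (Suc i) then 1 else 0)"

definition down_tensor :: "nat \<Rightarrow> nat \<Rightarrow> nat list \<Rightarrow> complex" where
  "down_tensor n m js = (if \<exists>i. Suc i < n \<and> js = Suc i # replicate (m - 1) i then 1 else 0)"

lemma up_tensor_nonzero:
  assumes "n \<ge> 2" "m \<ge> 2"
  shows "up_tensor n m \<in> nonzero_vectors (multi_indices n m)"
proof -
  have "up_tensor n m (0 # replicate (m - 1) (Suc 0)) \<noteq> 0"
    using assms by (auto simp: up_tensor_def)
  then have "up_tensor n m \<noteq> (\<lambda>_. 0)" by (metis (full_types))
  moreover have "up_tensor n m \<in> coord_space (multi_indices n m)"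
    using assms by (auto simp: up_tensor_def coord_space_def multi_indices_def)
  ultimately show ?thesis by (simp add: nonzero_vectors_def)
qed

lemma down_tensor_nonzero:
  assumes "n \<ge> 2" "m \<ge> 2"
  shows "down_tensor n m \<in> nonzero_vectors (multi_indices n m)"
proof -
  have "down_tensor n m (Suc 0 # replicate (m - 1) 0) \<noteq> 0"
    using assms by (auto simp: down_tensor_def)
  then have "down_tensor n m \<noteq> (\<lambda>_. 0)" by (metis (full_types))
  moreover have "down_tensor n m \<in> coord_space (multi_indices n m)"
    using assms by (auto simp: down_tensor_def coord_space_def multi_indices_def)
  ultimately show ?thesis by (simp add: nonzero_vectors_def)
qed

lemma hm_apply_up:
  "hm_apply n m (up_tensor n m) x i = (if Suc i < n then x (Suc i) ^ (m - 1) else 0)"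
proof (cases "Suc i < n")
  case True
  let ?r = "replicate (m - 1) (Suc i)"
  have "(\<Sum>js\<in>multi_indices n (m - 1). up_tensor n m (i # js) * mono_at x js) =
      (\<Sum>js\<in>{?r}. up_tensor n m (i # js) * mono_at x js)"
    using True finite_multi_indices
    by (intro sum.mono_neutral_right) (auto simp: up_tensor_def multi_indices_def)
  then show ?thesis using True by (simp add: hm_apply_def up_tensor_def prod_list_replicate)
qed (auto simp: hm_apply_def up_tensor_def)

lemma hm_apply_down:
  "hm_apply n m (down_tensor n m) x i = (if 0 < i \<and> i < n then x (i - 1) ^ (m - 1) else 0)"
proof (cases "0 < i \<and> i < n")
  case True
  then obtain k where i: "i = Suc k" by (cases i) auto
  let ?r = "replicate (m - 1) k"
  have "(\<Sum>js\<in>multi_indices n (m - 1). down_tensor n m (i # js) * mono_at x js) =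
      (\<Sum>js\<in>{?r}. down_tensor n m (i # js) * mono_at x js)"
    using True i finite_multi_indices
    by (intro sum.mono_neutral_right) (auto simp: down_tensor_def multi_indices_def)
  then show ?thesis using True i by (simp add: hm_apply_def down_tensor_def prod_list_replicate)
qed (auto simp: hm_apply_def down_tensor_def)

text \<open>Eliminates the eigenvalue: these are the 2 by 2 minors of the matrix whose columns are
  the image of \<open>x\<close> and \<open>x\<close> itself.\<close>

lemma eigenpairs_cross:
  assumes "(l, x) \<in> eigenpairs n m A"
  shows "hm_apply n m A x i * x j = hm_apply n m A x j * x i"
  using assms by (simp add: eigenpairs_def)

text \<open>As \<open>\<kappa>\<close> vanishes on the line \<open>up + t * down\<close>, the determinant is a nonzero constant there.\<close>

lemma up_tensor_pencil_fdet:
  assumes n: "n \<ge> 2" and m: "m \<ge> 2"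
  shows "\<exists>(S :: nat list set) \<kappa>. finite S \<and>
    (\<forall>\<mu>\<in>S. \<forall>\<nu>\<in>S. \<kappa> \<mu> \<nu> \<in> param_polys (multi_indices n m) \<and> (\<forall>t. \<kappa> \<mu> \<nu> (up_tensor n m, t) = 0)) \<and>
    (\<forall>a t. infinitely_many_eigenpairs n m (\<lambda>js. a js + t * down_tensor n m js) \<longrightarrow>
      fdet S (\<lambda>\<mu> \<nu>. (if \<mu> = \<nu> then 1 else 0) - \<kappa> \<mu> \<nu> (a, t)) = 0)"
proof -
  let ?p = "up_tensor n m" and ?q = "down_tensor n m" and ?I = "multi_indices n m"
  \<comment> \<open>These coefficients vanish along the line through \<open>?p\<close> in direction
    \<open>?q\<close>. Multiplication by the parameter preserves them, as the terms with
    \<open>\<tau>\<close> require.\<close>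
  define K where "K = {f \<in> param_polys ?I. \<forall>t. f (?p, t) = 0}"
  define E where "E = {((a, t), x). \<exists>l. (l, x) \<in> eigenpairs n m (\<lambda>js. a js + t * ?q js)}"
  define d where "d = m - 1"
  have d: "d \<ge> 1" "m = Suc d" "m - 1 = d" using m by (auto simp: d_def)
  note alg = fun_algebraD[OF fun_algebra_param_polys[of ?I]]
  have K: "coeff_module K"
    unfolding coeff_module_def K_def by (auto intro: alg)
  have \<tau>: "(\<lambda>w. snd w * f w) \<in> K" if "f \<in> K" for f
    using that by (auto simp: K_def intro: alg(3) param_polys_snd)
  define b where "b w js = fst w js + (-1) * ?p js" for w :: "(nat list \<Rightarrow> complex) \<times> complex" and js
  have b: "(\<lambda>w. b w js) \<in> K" if "js \<in> ?I" for js
  proof -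
    have "(\<lambda>w. fst w js + (-1) * ?p js) \<in> param_polys ?I"
      by (rule alg(2)[OF param_polys_fst[OF poly_funs.coord[OF that]] alg(1)])
    then show ?thesis by (simp add: b_def K_def)
  qed
  have rel: "\<exists>g\<in>lin_combs n K (Suc d). \<forall>(w, x)\<in>E.
      (\<lambda>_. 1) w * x (Suc k) ^ Suc d =
      (\<lambda>_. 1) w * ((if Suc (Suc k) < n then x k * x (Suc (Suc k)) ^ d else 0) + snd w * x k ^ Suc d
        - (if k = 0 then 0 else snd w * (x (k - 1) ^ d * x (Suc k)))) + g w x" if k: "Suc k < n" for k
  proof -
    \<comment> \<open>The share of \<open>a - p\<close> in the cross relation for the coordinates
      \<open>k\<close> and \<open>Suc k\<close>; the shares of \<open>p\<close> and
      \<open>t * q\<close> are the explicit monomials.\<close>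
    define g where "g w x = hm_apply n m (b w) x (Suc k) * x k +
      (-1) * (hm_apply n m (b w) x k * x (Suc k))" for w x
    have "g \<in> lin_combs n K (Suc d)"
    proof -
      have neg: "(\<lambda>w. (-1) * f w) \<in> K" if "f \<in> K" for f
        using K that unfolding coeff_module_def by blast
      have *: "(\<lambda>w x. hm_apply n m (b w) x i * x j) \<in> lin_combs n K (Suc d)" if "i < n" "j < n" for i j
        using lin_combs_hm_apply[of K m n b "\<lambda>i. i" i j] K b that d by simp
      show ?thesis
        unfolding g_def using k by (intro lin_combs_add K * lin_combs_scale neg) auto
    qed
    moreover have "x (Suc k) ^ Suc d =
      ((if Suc (Suc k) < n then x k * x (Suc (Suc k)) ^ d else 0) + snd w * x k ^ Suc d
        - (if k = 0 then 0 else snd w * (x (k - 1) ^ d * x (Suc k)))) + g w x" if wx: "(w, x) \<in> E" for w x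
    proof -
      obtain a t where w: "w = (a, t)" by (cases w)
      obtain l where l: "(l, x) \<in> eigenpairs n m (\<lambda>js. a js + t * ?q js)"
        using wx by (auto simp: E_def w)
      have "a = (\<lambda>js. b w js + 1 * ?p js)" by (auto simp: b_def w)
      then have F: "hm_apply n m (\<lambda>js. a js + t * ?q js) x i =
        hm_apply n m (b w) x i + hm_apply n m ?p x i + t * hm_apply n m ?q x i" for i
        by (metis (no_types) hm_apply_add mult_1)
      show ?thesis
        using eigenpairs_cross[OF l, of k "Suc k"] k unfolding F hm_apply_up hm_apply_down g_def w d(3)
        by (cases "k = 0") (simp_all add: algebra_simps split: if_splits)
    qed
    ultimately show ?thesis by fastforce
  qed
  define N where "N = n * d"
  have red: "\<forall>\<mu>\<in>multi_indices n (Suc N). reducible n K (\<lambda>_. 1) E N (\<lambda>w x. mono_at x \<mu>)"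
    by (rule ballI, rule reducible_monomials[OF d(1) K \<tau> rel]) (simp_all add: N_def)
  have "n \<ge> 1" using n by simp
  from reducible_imp_fdet[OF m this bij_betw_id[unfolded id_def] red] obtain \<kappa> where
    \<kappa>: "\<forall>\<mu>\<in>multi_indices n (Suc N). \<forall>\<nu>\<in>multi_indices n (Suc N). \<kappa> \<mu> \<nu> \<in> K"
    and det: "\<forall>w A. (\<forall>l x. (l, x) \<in> eigenpairs n m A \<longrightarrow> (w, \<lambda>i. x i) \<in> E) \<longrightarrow>
      infinitely_many_eigenpairs n m A \<longrightarrow>
      fdet (multi_indices n (Suc N)) (\<lambda>\<mu> \<nu>. (if \<mu> = \<nu> then 1 else 0) - \<kappa> \<mu> \<nu> w) = 0"
    by (elim exE conjE)
  show ?thesis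
  proof (intro exI[of _ "multi_indices n (Suc N)"] exI[of _ \<kappa>] conjI ballI allI impI)
    show "fdet (multi_indices n (Suc N)) (\<lambda>\<mu> \<nu>. (if \<mu> = \<nu> then 1 else 0) - \<kappa> \<mu> \<nu> (a, t)) = 0"
      if "infinitely_many_eigenpairs n m (\<lambda>js. a js + t * ?q js)" for a t
      by (rule det[rule_format, OF _ that]) (auto simp: E_def)
  qed (use \<kappa> finite_multi_indices in \<open>auto simp: K_def\<close>)
qed

text \<open>Reversing the indices turns \<open>down\<close> into \<open>up\<close>. Now \<open>t\<close> is an eigenvalue of the matrix \<open>\<kappa> a\<close>.\<close>

lemma down_tensor_pencil_fdet:
  assumes n: "n \<ge> 2" and m: "m \<ge> 2"
  shows "\<exists>(S :: nat list set) \<kappa>. finite S \<and>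
    (\<forall>\<mu>\<in>S. \<forall>\<nu>\<in>S. \<kappa> \<mu> \<nu> \<in> poly_funs (multi_indices n m) \<and> \<kappa> \<mu> \<nu> (\<lambda>_. 0) = 0) \<and>
    (\<forall>a t. infinitely_many_eigenpairs n m (\<lambda>js. a js + t * down_tensor n m js) \<longrightarrow>
      fdet S (\<lambda>\<mu> \<nu>. (if \<mu> = \<nu> then t else 0) - \<kappa> \<mu> \<nu> a) = 0)"
proof -
  let ?q = "down_tensor n m" and ?I = "multi_indices n m"
  define \<sigma> where "\<sigma> i = n - 1 - i" for i
  have \<sigma>\<sigma>: "\<sigma> (\<sigma> i) = i" "\<sigma> i < n" if "i < n" for i using that by (auto simp: \<sigma>_def)
  have \<sigma>: "bij_betw \<sigma> {..<n} {..<n}"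
    by (rule bij_betw_byWitness[of _ \<sigma>]) (use \<sigma>\<sigma> in auto)
  \<comment> \<open>The parameter is kept out of \<open>K\<close> on purpose: it enters the
    determinant only through \<open>s\<close>, that is, on the diagonal, so the determinant becomes
    a characteristic polynomial in \<open>t\<close>.\<close>
  define K :: "((nat list \<Rightarrow> complex) \<times> complex \<Rightarrow> complex) set"
    where "K = {\<phi>. \<exists>f\<in>poly_funs ?I. f (\<lambda>_. 0) = 0 \<and> \<phi> = (\<lambda>w. f (fst w))}"
  define E where "E = {((a, t), \<lambda>i. x (\<sigma> i)) |a t l x. (l, x) \<in> eigenpairs n m (\<lambda>js. a js + t * ?q js)}"
  define d where "d = m - 1"
  have d: "d \<ge> 1" "m = Suc d" "m - 1 = d" using m by (auto simp: d_def)
  have KI: "(\<lambda>w. f (fst w)) \<in> K" if "f \<in> poly_funs ?I" "f (\<lambda>_. 0) = 0" for f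
    using that by (auto simp: K_def)
  have K: "coeff_module K"
    unfolding coeff_module_def
  proof (intro conjI ballI allI)
    show "(\<lambda>_. 0) \<in> K" by (rule KI[OF poly_funs.const]) simp
    fix \<phi> assume "\<phi> \<in> K"
    then obtain f where f: "f \<in> poly_funs ?I" "f (\<lambda>_. 0) = 0" "\<phi> = (\<lambda>w. f (fst w))"
      by (auto simp: K_def)
    show "(\<lambda>w. c * \<phi> w) \<in> K" for c
      unfolding f(3) using f(2) by (intro KI poly_funs.mult poly_funs.const f(1)) simp
    fix \<psi> assume "\<psi> \<in> K"
    then obtain g where g: "g \<in> poly_funs ?I" "g (\<lambda>_. 0) = 0" "\<psi> = (\<lambda>w. g (fst w))"
      by (auto simp: K_def)
    show "(\<lambda>w. \<phi> w + \<psi> w) \<in> K"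
      unfolding f(3) g(3) using f(2) g(2) by (intro KI poly_funs.add f(1) g(1)) simp
  qed
  \<comment> \<open>After reversal \<open>q\<close> plays the part of \<open>p\<close> with
    coefficient \<open>t\<close>, and all of \<open>a\<close> is error term. There is no opposite
    tensor left, hence \<tau> = 0.\<close>
  have \<tau>: "(\<lambda>w. (\<lambda>_. 0) w * f w) \<in> K" if "f \<in> K" for f
    using K by (simp add: coeff_module_def)
  have coord: "(\<lambda>w. fst w js) \<in> K" if "js \<in> ?I" for js
    using KI[OF poly_funs.coord[OF that]] by simp
  have rel: "\<exists>g\<in>lin_combs n K (Suc d). \<forall>(w, y)\<in>E.
      snd w * y (Suc k) ^ Suc d =
      snd w * ((if Suc (Suc k) < n then y k * y (Suc (Suc k)) ^ d else 0) + (\<lambda>_. 0) w * y k ^ Suc d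
        - (if k = 0 then 0 else (\<lambda>_. 0) w * (y (k - 1) ^ d * y (Suc k)))) + g w y" if k: "Suc k < n" for k
  proof -
    define g :: "(nat list \<Rightarrow> complex) \<times> complex \<Rightarrow> (nat \<Rightarrow> complex) \<Rightarrow> complex"
      where "g w y = hm_apply n m (fst w) (\<lambda>i. y (\<sigma> i)) (\<sigma> (Suc k)) * y k +
      (-1) * (hm_apply n m (fst w) (\<lambda>i. y (\<sigma> i)) (\<sigma> k) * y (Suc k))" for w y
    have "g \<in> lin_combs n K (Suc d)"
    proof -
      have neg: "(\<lambda>w. (-1) * f w) \<in> K" if "f \<in> K" for f
        using K that unfolding coeff_module_def by blast
      have *: "(\<lambda>w y. hm_apply n m (fst w) (\<lambda>i. y (\<sigma> i)) (\<sigma> i) * y j) \<in> lin_combs n K (Suc d)"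
        if "i < n" "j < n" for i j
        using lin_combs_hm_apply[of K m n fst \<sigma> "\<sigma> i" j] K coord that d \<sigma>\<sigma> by simp
      show ?thesis
        unfolding g_def using k by (intro lin_combs_add K * lin_combs_scale neg) auto
    qed
    moreover have "snd w * y (Suc k) ^ Suc d =
      snd w * (if Suc (Suc k) < n then y k * y (Suc (Suc k)) ^ d else 0) + g w y" if wy: "(w, y) \<in> E" for w y
    proof -
      obtain a t l x where w: "w = (a, t)" and y: "y = (\<lambda>i. x (\<sigma> i))"
        and l: "(l, x) \<in> eigenpairs n m (\<lambda>js. a js + t * ?q js)"
        using wy by (auto simp: E_def)
      have g: "g w y = hm_apply n m a x (\<sigma> (Suc k)) * y k + (-1) * (hm_apply n m a x (\<sigma> k) * y (Suc k))"
        unfolding g_def w y by (simp add: hm_apply_cong[of n "\<lambda>i. x (\<sigma> (\<sigma> i))" x] \<sigma>\<sigma>)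
      have q: "hm_apply n m ?q x (\<sigma> i) = (if Suc i < n then y (Suc i) ^ d else 0)" if "i < n" for i
        unfolding hm_apply_down y d(3) using that by (auto simp: \<sigma>_def)
      have "hm_apply n m (\<lambda>js. a js + t * ?q js) x (\<sigma> k) * y (Suc k) =
        hm_apply n m (\<lambda>js. a js + t * ?q js) x (\<sigma> (Suc k)) * y k"
        unfolding y by (rule eigenpairs_cross[OF l])
      then show ?thesis
        using k unfolding hm_apply_add g by (simp add: w q algebra_simps split: if_splits)
    qed
    ultimately show ?thesis by fastforce
  qed
  define N where "N = n * d"
  have red: "\<forall>\<mu>\<in>multi_indices n (Suc N). reducible n K snd E N (\<lambda>w x. mono_at x \<mu>)"
    by (rule ballI, rule reducible_monomials[OF d(1) K \<tau> rel]) (simp_all add: N_def)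
  have "n \<ge> 1" using n by simp
  from reducible_imp_fdet[OF m this \<sigma> red] obtain \<kappa> where
    \<kappa>: "\<forall>\<mu>\<in>multi_indices n (Suc N). \<forall>\<nu>\<in>multi_indices n (Suc N). \<kappa> \<mu> \<nu> \<in> K"
    and det: "\<forall>w A. (\<forall>l x. (l, x) \<in> eigenpairs n m A \<longrightarrow> (w, \<lambda>i. x (\<sigma> i)) \<in> E) \<longrightarrow>
      infinitely_many_eigenpairs n m A \<longrightarrow>
      fdet (multi_indices n (Suc N)) (\<lambda>\<mu> \<nu>. (if \<mu> = \<nu> then snd w else 0) - \<kappa> \<mu> \<nu> w) = 0"
    by (elim exE conjE)
  have \<kappa>': "\<exists>f\<in>poly_funs ?I. f (\<lambda>_. 0) = 0 \<and> \<kappa> \<mu> \<nu> = (\<lambda>w. f (fst w))"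
    if "\<mu> \<in> multi_indices n (Suc N)" "\<nu> \<in> multi_indices n (Suc N)" for \<mu> \<nu>
    using \<kappa> that by (simp add: K_def)
  show ?thesis
  \<comment> \<open>The second component 0 is arbitrary, since functions in \<open>K\<close> depend
    on the first component only.\<close>
  proof (intro exI[of _ "multi_indices n (Suc N)"] exI[of _ "\<lambda>\<mu> \<nu> a. \<kappa> \<mu> \<nu> (a, 0)"] conjI ballI allI impI)
    show "finite (multi_indices n (Suc N))" by (rule finite_multi_indices)
    fix \<mu> \<nu> assume \<mu>\<nu>: "\<mu> \<in> multi_indices n (Suc N)" "\<nu> \<in> multi_indices n (Suc N)"
    from \<kappa>'[OF this] show "(\<lambda>a. \<kappa> \<mu> \<nu> (a, 0)) \<in> poly_funs ?I" by force
    from \<kappa>'[OF \<mu>\<nu>] show "\<kappa> \<mu> \<nu> (\<lambda>_. 0, 0) = 0" by force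
  next
    fix a t assume inf: "infinitely_many_eigenpairs n m (\<lambda>js. a js + t * ?q js)"
    have "fdet (multi_indices n (Suc N)) (\<lambda>\<mu> \<nu>. (if \<mu> = \<nu> then snd (a, t) else 0) - \<kappa> \<mu> \<nu> (a, t)) = 0"
      by (rule det[rule_format, OF _ inf]) (auto simp: E_def)
    moreover have "fdet (multi_indices n (Suc N)) (\<lambda>\<mu> \<nu>. (if \<mu> = \<nu> then snd (a, t) else 0) - \<kappa> \<mu> \<nu> (a, t)) =
      fdet (multi_indices n (Suc N)) (\<lambda>\<mu> \<nu>. (if \<mu> = \<nu> then t else 0) - \<kappa> \<mu> \<nu> (a, 0))"
    proof (rule fdet_cong[OF finite_multi_indices])
      fix \<mu> \<nu> assume "\<mu> \<in> multi_indices n (Suc N)" "\<nu> \<in> multi_indices n (Suc N)"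
      from \<kappa>'[OF this] show "(if \<mu> = \<nu> then snd (a, t) else 0) - \<kappa> \<mu> \<nu> (a, t) =
        (if \<mu> = \<nu> then t else 0) - \<kappa> \<mu> \<nu> (a, 0)" by force
    qed
    ultimately show "fdet (multi_indices n (Suc N)) (\<lambda>\<mu> \<nu>. (if \<mu> = \<nu> then t else 0) - \<kappa> \<mu> \<nu> (a, 0)) = 0"
      by simp
  qed
qed

theorem theorem6:
  fixes n m :: nat
  assumes "n \<ge> 2" and "m \<ge> 2"
  shows "codimension (zariski (multi_indices n m)) (degenerate_classes n m) \<ge> 2"
proof -
  let ?I = "multi_indices n m" and ?p = "up_tensor n m" and ?q = "down_tensor n m"
  define D where "D = {A \<in> nonzero_vectors ?I. infinitely_many_eigenpairs n m A}"
  have D: "is_cone ?I D"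
    using nonzero_vectors_scale infinitely_many_eigenpairs_scale[OF assms(2)]
    unfolding is_cone_def D_def by blast
  have deg: "degenerate_classes n m = lines ?I D"
    by (auto simp: degenerate_classes_def lines_def D_def)
  obtain S \<kappa> where S: "finite (S :: nat list set)"
    and \<kappa>: "\<forall>\<mu>\<in>S. \<forall>\<nu>\<in>S. \<kappa> \<mu> \<nu> \<in> param_polys ?I \<and> (\<forall>t. \<kappa> \<mu> \<nu> (?p, t) = 0)"
    and \<kappa>det: "\<forall>a t. infinitely_many_eigenpairs n m (\<lambda>js. a js + t * ?q js) \<longrightarrow>
      fdet S (\<lambda>\<mu> \<nu>. (if \<mu> = \<nu> then 1 else 0) - \<kappa> \<mu> \<nu> (a, t)) = 0"
    using up_tensor_pencil_fdet[OF assms] by (elim exE conjE)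
  obtain T \<theta> where T: "finite (T :: nat list set)"
    and \<theta>: "\<forall>\<mu>\<in>T. \<forall>\<nu>\<in>T. \<theta> \<mu> \<nu> \<in> poly_funs ?I \<and> \<theta> \<mu> \<nu> (\<lambda>_. 0) = 0"
    and \<theta>det: "\<forall>a t. infinitely_many_eigenpairs n m (\<lambda>js. a js + t * ?q js) \<longrightarrow>
      fdet T (\<lambda>\<mu> \<nu>. (if \<mu> = \<nu> then t else 0) - \<theta> \<mu> \<nu> a) = 0"
    using down_tensor_pencil_fdet[OF assms] by (elim exE conjE)
  have \<theta>_poly: "\<forall>\<mu>\<in>T. \<forall>\<nu>\<in>T. \<theta> \<mu> \<nu> \<in> poly_funs ?I"
    using \<theta> by blast
  \<comment> \<open>The subtraction is spelled as adding \<open>(-1)\<close> times a term, the shape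
    for which the algebra rules apply. Along \<open>?p\<close> all entries of
    \<open>\<kappa>\<close> vanish, so \<phi> is there a nonzero constant in \<open>t\<close>, as
    the last clause of the elimination asks.\<close>
  define \<phi> where "\<phi> w = fdet S (\<lambda>\<mu> \<nu>. (if \<mu> = \<nu> then 1 else 0) + (-1) * \<kappa> \<mu> \<nu> w)" for w
  have \<phi>: "\<phi> \<in> param_polys ?I"
    unfolding \<phi>_def
    by (intro fdet_in_fun_algebra[OF fun_algebra_param_polys S]
        fun_algebraD[OF fun_algebra_param_polys] \<kappa>[rule_format, THEN conjunct1])
  obtain R where R: "R \<in> poly_funs ?I"
    "\<forall>a t w. \<phi> (a, t) = 0 \<longrightarrow> (\<exists>\<mu>\<in>T. w \<mu> \<noteq> 0) \<longrightarrow>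
      (\<forall>\<mu>\<in>T. (\<Sum>\<nu>\<in>T. \<theta> \<mu> \<nu> a * w \<nu>) = t * w \<mu>) \<longrightarrow> R a = 0"
    "\<forall>a c. c \<noteq> 0 \<longrightarrow> (\<forall>t. \<phi> (a, t) = c) \<longrightarrow> R a \<noteq> 0"
    using eliminate_parameter[OF T \<phi> \<theta>_poly] by (elim bexE conjE)
  \<comment> \<open>The second determinant at \<open>a - q\<close> with parameter 1, because
    \<open>a\<close> is \<open>(a - q) + 1 * q\<close>. At \<open>a = q\<close> the argument of
    \<open>\<theta>\<close> is zero and the identity matrix remains.\<close>
  define G where "G a = fdet T (\<lambda>\<mu> \<nu>. (if \<mu> = \<nu> then 1 else 0) + (-1) * \<theta> \<mu> \<nu> (\<lambda>js. 1 * a js + - ?q js))"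
    for a
  show ?thesis
    unfolding deg
  proof (rule codimension_ge_2[OF D, of ?p ?q G R])
    show "?p \<in> nonzero_vectors ?I" "?q \<in> nonzero_vectors ?I"
      using up_tensor_nonzero down_tensor_nonzero assms by auto
    show "G \<in> poly_funs ?I"
      unfolding G_def
      by (intro fdet_in_fun_algebra[OF fun_algebra_poly_funs T] poly_funs.add poly_funs.mult
          poly_funs.const poly_funs_affine \<theta>_poly[rule_format])
    show "G a = 0" if "a \<in> D" for a
      using \<theta>det[rule_format, of "\<lambda>js. 1 * a js + - ?q js" 1] that by (simp add: G_def D_def)
    have "G ?q = fdet T (\<lambda>\<mu> \<nu>. if \<mu> = \<nu> then 1 else 0)"
      unfolding G_def by (rule fdet_cong[OF T]) (simp add: \<theta>)
    then show "G ?q \<noteq> 0" using fdet_scalar_nonzero[OF T, of 1] by simp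
    show "R \<in> poly_funs ?I" by (rule R(1))
    show "R a = 0" if "(\<lambda>js. a js + t * ?q js) \<in> D" for a t
    proof -
      have inf: "infinitely_many_eigenpairs n m (\<lambda>js. a js + t * ?q js)"
        using that by (simp add: D_def)
      \<comment> \<open>A kernel vector of the second determinant is an eigenvector of the matrix
        \<open>\<theta>\<close> at \<open>a\<close> for the eigenvalue \<open>t\<close>, exactly the
        input of the elimination.\<close>
      obtain w where w: "\<exists>\<mu>\<in>T. w \<mu> \<noteq> 0"
        "\<And>\<mu>. \<mu> \<in> T \<Longrightarrow> (\<Sum>\<nu>\<in>T. ((if \<mu> = \<nu> then t else 0) - \<theta> \<mu> \<nu> a) * w \<nu>) = 0"
        using \<theta>det[rule_format, OF inf] unfolding fdet_eq_0_iff[OF T] by blast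
      have "(\<Sum>\<nu>\<in>T. \<theta> \<mu> \<nu> a * w \<nu>) = t * w \<mu>" if "\<mu> \<in> T" for \<mu>
        using w(2)[OF that] that T
        by (simp add: left_diff_distrib sum_subtractf if_distrib[of "\<lambda>x. x * _"] sum.delta
            cong: if_cong)
      moreover have "\<phi> (a, t) = 0" using \<kappa>det[rule_format, OF inf] by (simp add: \<phi>_def)
      ultimately show ?thesis using R(2) w(1) by blast
    qed
    have "\<phi> (?p, t) = fdet S (\<lambda>\<mu> \<nu>. if \<mu> = \<nu> then 1 else 0)" for t
      unfolding \<phi>_def by (rule fdet_cong[OF S]) (simp add: \<kappa>)
    then show "R ?p \<noteq> 0" using R(3)[rule_format, OF fdet_scalar_nonzero[OF S, of 1]] by simp
  qed
qed

end
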